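(* Let $K>0$ and let $\{X_t\}_{t\in\mathbb Z}$ be a stationary ergodic process with values in $\mathcal X=[-K,K]$ and distribution $P$. Let $\hat P(dx\mid X^{-t})$, $t\ge0$, be the weakly consistent sequence of conditional distribution estimates defined in the context, let $\hat X_{-t}=\int x\,\hat P(dx\mid X^{-t})$, let $\hat X=E\{X\mid X^-\}=\int x\,P(dx\mid X^-)$, and let $\hat X_t=\int x_t\,\hat P(dx_t\mid X^t)$. Then $$|X-\hat X_{-t}|^2\to|X-\hat X|^2\quad\text{in }L^1(P)\text{ as }t\to\infty,$$ and consequently $$\frac1n\sum_{0\le t<n}|X_t-\hat X_t|^2\to E|X-\hat X|^2\quad\text{in }L^1(P)\text{ as }n\to\infty.$$
   Context: Notation: $X=X_0$; $X^t=(X_0,\ldots,X_{t-1})$; $X^{-t}=(X_{-t},\ldots,X_{-1})$ (both empty for $t=0$); $X^-=(\ldots,X_{-2},X_{-1})$. ($\hat X_{-t}$ is an estimate of $X_0$ based on $X^{-t}$, not an estimate of $X_{-t}$.) Estimates: let $\{\mathcal B_k\}_{k\ge1}$ be an increasing sequence of finite fields generated by intervals with $\sigma(\bigcup_k\mathcal B_k)$ equal to the Borel $\sigma$-field of $\mathbb R$; let $\Xi_k$ be the set of atoms of $\mathcal B_k$, and let $[x]^k$ be the atom of $\mathcal B_k$ containing $x$. Let $\{\ell_k\}$, $\{J_k\}$ be nondecreasing unbounded sequences of positive integers. Put $\tau^k_0=0$ and, for $j\ge1$, $$\tau^k_j=\min\{t>\tau^k_{j-1}:\ ([X_{-\ell_k-t}]^k,\ldots,[X_{-1-t}]^k)=([X_{-\ell_k}]^k,\ldots,[X_{-1}]^k)\},$$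 $\lambda_k=\ell_k+\tau^k_{J_k}$, and $\hat P_k(dx\mid X^{-\lambda_k})=\frac1{J_k}\sum_{1\le j\le J_k}\delta_{X_{-\tau^k_j}}(dx)$. Let $k(n)$ be a nondecreasing unbounded sequence of positive integers such that, for some $\varepsilon_k>0$ with $\varepsilon_k\to0$, $n\ge\ell_{k(n)}+J_{k(n)}|\Xi_{k(n)}|^{\ell_{k(n)}}/\varepsilon_{k(n)}$ for all sufficiently large $n$. Let $Q(dx)$ be a default probability measure on $[-K,K]$ (for instance the unit mass at $0$). Then $\hat P(dx\mid X^{-n})$ is $\hat P_{k(n)}(dx\mid X^{-\lambda_{k(n)}})$ if $\lambda_{k(n)}\le n$ and $Q(dx)$ otherwise. The estimate $\hat P(dx_t\mid X^t)$ is constructed from $X^t$ in the same way as $\hat P(dx\mid X^{-t})$ is constructed from $X^{-t}$ (the same function applied to $(X_0,\ldots,X_{t-1})$ in place of $(X_{-t},\ldots,X_{-1})$). *)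

theory Defs
  imports "HOL-Probability.Probability"
begin

definition path_law :: "'a measure \<Rightarrow> (int \<Rightarrow> 'a \<Rightarrow> real) \<Rightarrow> (int \<Rightarrow> real) measure" where
  "path_law M X = distr M (Pi\<^sub>M UNIV (\<lambda>_. borel)) (\<lambda>\<omega> t. X t \<omega>)"

definition shift :: "(int \<Rightarrow> real) \<Rightarrow> int \<Rightarrow> real" where
  "shift x = (\<lambda>t. x (t + 1))"

definition stationary :: "'a measure \<Rightarrow> (int \<Rightarrow> 'a \<Rightarrow> real) \<Rightarrow> bool" where
  "stationary M X \<longleftrightarrow>
     distr (path_law M X) (Pi\<^sub>M UNIV (\<lambda>_. borel)) shift = path_law M X"

definition ergodic :: "'a measure \<Rightarrow> (int \<Rightarrow> 'a \<Rightarrow> real) \<Rightarrow> bool" where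
  "ergodic M X \<longleftrightarrow>
     (\<forall>A \<in> sets (Pi\<^sub>M UNIV (\<lambda>_. borel)). shift -` A = A \<longrightarrow> measure (path_law M X) A \<in> {0, 1})"

definition past_algebra :: "'a measure \<Rightarrow> (int \<Rightarrow> 'a \<Rightarrow> real) \<Rightarrow> 'a measure" where
  "past_algebra M X =
     vimage_algebra (space M) (\<lambda>\<omega>. \<lambda>t\<in>{..<0}. X t \<omega>) (Pi\<^sub>M {..<0} (\<lambda>_. borel))"

definition past_mean :: "'a measure \<Rightarrow> (int \<Rightarrow> 'a \<Rightarrow> real) \<Rightarrow> 'a \<Rightarrow> real" where
  "past_mean M X = real_cond_exp M (past_algebra M X) (X 0)"

text \<open>Integrability is part of the definition because the integral of a non-integrable
  function is \<open>0\<close> by convention.\<close>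

definition L1_tendsto :: "'a measure \<Rightarrow> (nat \<Rightarrow> 'a \<Rightarrow> real) \<Rightarrow> ('a \<Rightarrow> real) \<Rightarrow> bool" where
  "L1_tendsto M f g \<longleftrightarrow>
     (\<forall>n. integrable M (f n)) \<and> integrable M g \<and>
     (\<lambda>n. \<integral>\<omega>. \<bar>f n \<omega> - g \<omega>\<bar> \<partial>M) \<longlonglongrightarrow> 0"

definition generated_by_intervals :: "real set set \<Rightarrow> bool" where
  "generated_by_intervals B \<longleftrightarrow> (\<exists>I. (\<forall>S\<in>I. is_interval S) \<and> B = algebra UNIV hull I)"

definition atoms :: "'a set set \<Rightarrow> 'a set set" where
  "atoms B = {A \<in> B. A \<noteq> {} \<and> (\<forall>C\<in>B. C \<subseteq> A \<longrightarrow> C = {} \<or> C = A)}"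

definition cell :: "'a set set \<Rightarrow> 'a \<Rightarrow> 'a set" where
  "cell B x = (THE A. A \<in> atoms B \<and> x \<in> A)"

text \<open>A path \<open>x :: int \<Rightarrow> real\<close> is observed from time \<open>0\<close>. The infimum of the empty set in
  \<^typ>\<open>enat\<close> is \<open>\<infinity>\<close>, so a recurrence time that does not exist is infinite.\<close>

primrec recurrence_time :: "real set set \<Rightarrow> nat \<Rightarrow> (int \<Rightarrow> real) \<Rightarrow> nat \<Rightarrow> enat" where
  "recurrence_time B l x 0 = 0"
| "recurrence_time B l x (Suc j) =
     Inf {enat t | t. recurrence_time B l x j < enat t \<and>
       (\<forall>i\<in>{1..l}. cell B (x (- int i - int t)) = cell B (x (- int i)))}"

definition sample_length :: "real set set \<Rightarrow> nat \<Rightarrow> nat \<Rightarrow> (int \<Rightarrow> real) \<Rightarrow> enat" where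
  "sample_length B l J x = enat l + recurrence_time B l x J"

text \<open>The image of the uniform distribution on \<open>{1..J}\<close> is the average of the unit masses at
  \<open>x (- \<tau> j)\<close>. It is only used when all \<open>\<tau> j\<close> with \<open>j \<le> J\<close> are finite.\<close>

definition empirical_estimate :: "real set set \<Rightarrow> nat \<Rightarrow> nat \<Rightarrow> (int \<Rightarrow> real) \<Rightarrow> real measure" where
  "empirical_estimate B l J x =
     distr (uniform_count_measure {1..J}) borel
       (\<lambda>j. x (- int (the_enat (recurrence_time B l x j))))"

definition cond_dist_estimate ::
  "(nat \<Rightarrow> real set set) \<Rightarrow> (nat \<Rightarrow> nat) \<Rightarrow> (nat \<Rightarrow> nat) \<Rightarrow> (nat \<Rightarrow> nat) \<Rightarrow> real measure
    \<Rightarrow> nat \<Rightarrow> (int \<Rightarrow> real) \<Rightarrow> real measure" where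
  "cond_dist_estimate B l J k Q n x =
     (if sample_length (B (k n)) (l (k n)) (J (k n)) x \<le> enat n
      then empirical_estimate (B (k n)) (l (k n)) (J (k n)) x else Q)"

text \<open>The estimate is a function of the block \<open>(x (-n), \<dots>, x (-1))\<close> alone
  (lemma \<open>cond_dist_estimate_cong\<close>), so evaluating it on the path moved by \<open>t\<close> steps
  applies that function to \<open>(X 0, \<dots>, X (t - 1))\<close>.\<close>

definition backward_mean ::
  "(nat \<Rightarrow> real set set) \<Rightarrow> (nat \<Rightarrow> nat) \<Rightarrow> (nat \<Rightarrow> nat) \<Rightarrow> (nat \<Rightarrow> nat) \<Rightarrow> real measure
    \<Rightarrow> (int \<Rightarrow> 'a \<Rightarrow> real) \<Rightarrow> nat \<Rightarrow> 'a \<Rightarrow> real" where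
  "backward_mean B l J k Q X t \<omega> = (\<integral>x. x \<partial>cond_dist_estimate B l J k Q t (\<lambda>i. X i \<omega>))"

definition forward_mean ::
  "(nat \<Rightarrow> real set set) \<Rightarrow> (nat \<Rightarrow> nat) \<Rightarrow> (nat \<Rightarrow> nat) \<Rightarrow> (nat \<Rightarrow> nat) \<Rightarrow> real measure
    \<Rightarrow> (int \<Rightarrow> 'a \<Rightarrow> real) \<Rightarrow> nat \<Rightarrow> 'a \<Rightarrow> real" where
  "forward_mean B l J k Q X t \<omega> =
     (\<integral>x. x \<partial>cond_dist_estimate B l J k Q t (\<lambda>i. X (int t + i) \<omega>))"

lemma recurrence_time_mono:
  assumes "i \<le> j"
  shows "recurrence_time B l x i \<le> recurrence_time B l x j"
proof -
  have "recurrence_time B l x j \<le> recurrence_time B l x (Suc j)" for j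
    by (auto intro!: Inf_greatest)
  then show ?thesis
    using assms by (rule lift_Suc_mono_le)
qed

lemma recurrence_time_cong:
  assumes eq: "\<And>i. - int n \<le> i \<Longrightarrow> i < 0 \<Longrightarrow> x i = y i"
    and le: "enat l + recurrence_time B l x j \<le> enat n"
  shows "recurrence_time B l y j = recurrence_time B l x j"
  using le
proof (induction j)
  case (Suc j)
  define S where "S z = {t. recurrence_time B l z j < enat t \<and>
    (\<forall>i\<in>{1..l}. cell B (z (- int i - int t)) = cell B (z (- int i)))}" for z
  have rt: "recurrence_time B l z (Suc j) = Inf (enat ` S z)" for z
    by (auto simp: S_def intro!: arg_cong[where f = Inf])
  have "enat l + recurrence_time B l x j \<le> enat n"
    using Suc.prems recurrence_time_mono[of j "Suc j" B l x]
    by (meson add_left_mono le_SucI order.refl order.trans)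
  then have IH: "recurrence_time B l y j = recurrence_time B l x j"
    by (rule Suc.IH)
  have same: "t \<in> S x \<longleftrightarrow> t \<in> S y" if "l + t \<le> n" for t
  proof -
    have "x (- int i - int t) = y (- int i - int t)" "x (- int i) = y (- int i)"
      if "i \<in> {1..l}" for i
      using that \<open>l + t \<le> n\<close> by (auto intro!: eq)
    then show ?thesis
      unfolding S_def IH by simp
  qed
  have ne: "S x \<noteq> {}"
    using Suc.prems unfolding rt by (auto simp: Inf_enat_def)
  then have "Inf (enat ` S x) \<in> enat ` S x"
    unfolding Inf_enat_def by (metis LeastI ex_in_conv image_is_empty)
  then obtain t where t: "t \<in> S x" "Inf (enat ` S x) = enat t"
    by auto
  have ltn: "l + t \<le> n"
    using Suc.prems unfolding rt t(2) by simp
  have "Inf (enat ` S y) = enat t"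
  proof (rule antisym)
    show "Inf (enat ` S y) \<le> enat t"
      using t(1) same[OF ltn] by (auto intro: Inf_lower)
    show "enat t \<le> Inf (enat ` S y)"
    proof (rule Inf_greatest)
      fix s assume "s \<in> enat ` S y"
      then obtain u where u: "s = enat u" "u \<in> S y" by auto
      have "t \<le> u"
      proof (rule ccontr)
        assume "\<not> t \<le> u"
        then have "u \<in> S x" using same[of u] ltn u(2) by simp
        then have "Inf (enat ` S x) \<le> enat u" by (auto intro: Inf_lower)
        then show False using t(2) \<open>\<not> t \<le> u\<close> by simp
      qed
      then show "enat t \<le> s" using u by simp
    qed
  qed
  then show ?case unfolding rt t(2) .
qed simp

lemma cond_dist_estimate_cong:
  assumes eq: "\<And>i. - int n \<le> i \<Longrightarrow> i < 0 \<Longrightarrow> x i = y i"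
  shows "cond_dist_estimate B l J k Q n x = cond_dist_estimate B l J k Q n y"
proof -
  define B' l' J' where "B' = B (k n)" and "l' = l (k n)" and "J' = J (k n)"
  have rt: "recurrence_time B' l' y j = recurrence_time B' l' x j"
    if "sample_length B' l' J' x \<le> enat n" "j \<le> J'" for j
  proof (rule recurrence_time_cong[OF eq])
    show "enat l' + recurrence_time B' l' x j \<le> enat n"
      using that recurrence_time_mono[OF that(2), of B' l' x]
      unfolding sample_length_def by (meson add_left_mono order.trans)
  qed auto
  have rt': "recurrence_time B' l' x j = recurrence_time B' l' y j"
    if "sample_length B' l' J' y \<le> enat n" "j \<le> J'" for j
  proof (rule recurrence_time_cong[of n y x])
    show "enat l' + recurrence_time B' l' y j \<le> enat n"
      using that recurrence_time_mono[OF that(2), of B' l' y]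
      unfolding sample_length_def by (meson add_left_mono order.trans)
  qed (simp add: eq)
  have iff: "sample_length B' l' J' x \<le> enat n \<longleftrightarrow> sample_length B' l' J' y \<le> enat n"
    using rt[of J'] rt'[of J'] unfolding sample_length_def by auto
  have "empirical_estimate B' l' J' x = empirical_estimate B' l' J' y"
    if le: "sample_length B' l' J' x \<le> enat n"
    unfolding empirical_estimate_def
  proof (rule distr_cong)
    fix j assume "j \<in> space (uniform_count_measure {1..J'})"
    then have j: "1 \<le> j" "j \<le> J'" by (auto simp: space_uniform_count_measure)
    have "enat l' + recurrence_time B' l' x j \<le> enat n"
      using le recurrence_time_mono[OF j(2), of B' l' x]
      unfolding sample_length_def by (meson add_left_mono order.trans)
    then obtain t where t: "recurrence_time B' l' x j = enat t" "l' + t \<le> n"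
      by (cases "recurrence_time B' l' x j") auto
    have "recurrence_time B' l' x 0 < recurrence_time B' l' x 1"
    proof -
      have "1 \<le> recurrence_time B' l' x 1"
        by (auto intro!: Inf_greatest simp: one_enat_def zero_enat_def)
      then show ?thesis
        by (metis less_le_trans recurrence_time.simps(1) zero_less_one)
    qed
    then have "0 < recurrence_time B' l' x j"
      using recurrence_time_mono[OF j(1), of B' l' x]
      by (metis less_le_trans recurrence_time.simps(1))
    then have "0 < t" unfolding t(1) by (simp add: zero_enat_def)
    then show "x (- int (the_enat (recurrence_time B' l' x j))) =
        y (- int (the_enat (recurrence_time B' l' y j)))"
      unfolding rt[OF le j(2)] t(1) using t(2) by (simp add: eq)
  qed simp_all
  then show ?thesis
    using iff unfolding cond_dist_estimate_def B'_def l'_def J'_def by simp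
qed

end

theory Submission imports Defs begin

text \<open>
  Let \<open>m\<close> be the conditional mean of \<open>x 0\<close> given the past, on the space of paths with the law of
  the process. Everything rests on the map \<open>\<theta>\<close> that moves a path back to the last earlier
  occurrence of the word (the quantized block of the last \<open>l\<close> values) that it shows now.

  This map preserves the law (\<open>distr_return_map\<close>), and the mean of the estimate is the
  average of \<open>x 0\<close> over the paths \<open>\<theta> x, \<dots>, (\<theta> ^^ J) x\<close>. Split \<open>x 0\<close> into the innovation
  \<open>x 0 - m x\<close> and \<open>m x\<close>. The innovations along the return times are orthogonal, since each later
  sampled value lies in the past of an earlier one; their average is of order \<open>1 / sqrt J\<close>
  (\<open>innov_sum_square\<close>). The function \<open>m\<close> is approximated in \<open>L\<^sup>1\<close> by a function of a finite word
  (\<open>approx_by_labels\<close>), and such a function is constant along the orbit of \<open>\<theta>\<close> once the word in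
  use is at least as fine; so the average of \<open>m\<close> stays close to \<open>m\<close> (\<open>sample_mean_close\<close>). It
  remains to see that the sample fits into the observed block with high probability: the mean
  return time is at most the number of words (\<open>kac\<close>), and Markov's inequality turns the growth
  condition into \<open>prob_not_fits\<close>. Hence the estimates converge to \<open>m\<close> in \<open>L\<^sup>1\<close>
  (\<open>est_consistent\<close>). As everything is bounded, so do the squared errors.

  The error of the forward estimate at time \<open>t\<close> is the error of the backward estimate, evaluated
  on the path shifted by \<open>t\<close>. By the first part it differs little, in \<open>L\<^sup>1\<close>, from
  \<open>\<bar>x 0 - m x\<bar>\<^sup>2\<close> on the shifted path, and averages of the latter converge by the ergodic theorem.
  Birkhoff's theorem is derived here from the maximal ergodic inequality.
\<close>

section \<open>The ergodic theorem\<close>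

locale measure_preserving = prob_space M for M :: "'a measure" +
  fixes T :: "'a \<Rightarrow> 'a"
  assumes T_measurable [measurable]: "T \<in> M \<rightarrow>\<^sub>M M"
    and distr_T: "distr M M T = M"
begin

lemma funpow_measurable [measurable]: "(T ^^ n) \<in> M \<rightarrow>\<^sub>M M"
  by (induction n) (auto simp: comp_def id_def)

lemma distr_funpow: "distr M M (T ^^ n) = M"
proof (induction n)
  case 0
  then show ?case by (simp add: id_def distr_id2)
next
  case (Suc n)
  have "distr M M (T ^^ Suc n) = distr (distr M M (T ^^ n)) M T"
    by (subst distr_distr) auto
  also have "\<dots> = M" unfolding Suc distr_T ..
  finally show ?case .
qed

lemma nn_integral_funpow:
  assumes [measurable]: "f \<in> borel_measurable M"
  shows "(\<integral>\<^sup>+x. f ((T ^^ n) x) \<partial>M) = (\<integral>\<^sup>+x. f x \<partial>M)"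
proof -
  have "(\<integral>\<^sup>+x. f x \<partial>distr M M (T ^^ n)) = (\<integral>\<^sup>+x. f ((T ^^ n) x) \<partial>M)"
    by (intro nn_integral_distr) auto
  then show ?thesis by (simp add: distr_funpow)
qed

lemma integral_funpow:
  fixes f :: "'a \<Rightarrow> real"
  assumes [measurable]: "f \<in> borel_measurable M"
  shows "(\<integral>x. f ((T ^^ n) x) \<partial>M) = (\<integral>x. f x \<partial>M)"
proof -
  have "(\<integral>x. f x \<partial>distr M M (T ^^ n)) = (\<integral>x. f ((T ^^ n) x) \<partial>M)"
    by (intro integral_distr) auto
  then show ?thesis by (simp add: distr_funpow)
qed

lemma integrable_funpow:
  fixes f :: "'a \<Rightarrow> real"
  assumes f: "integrable M f"
  shows "integrable M (\<lambda>x. f ((T ^^ n) x))"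
proof -
  have "integrable (distr M M (T ^^ n)) f" using f by (simp add: distr_funpow)
  then show ?thesis by (rule integrable_distr[rotated]) simp
qed

lemma AE_funpow:
  assumes "AE x in M. Q x"
  shows "AE x in M. Q ((T ^^ n) x)"
proof -
  have "AE x in distr M M (T ^^ n). Q x" unfolding distr_funpow by (rule assms)
  then show ?thesis by (rule AE_distrD[rotated]) simp
qed

text \<open>Let \<open>m x\<close> be the largest of the partial sums \<open>S 0 x = 0, S 1 x, \<dots>, S n x\<close>. Where it is
  positive it is attained at a positive index, so peeling off the first summand gives
  \<open>m x \<le> f x + m (T x)\<close>; elsewhere \<open>m x = 0 \<le> m (T x)\<close>. Integration kills \<open>m - m \<circ> T\<close>.\<close>

lemma maximal_ergodic:
  fixes f :: "'a \<Rightarrow> real" and n :: nat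
  assumes f: "integrable M f"
  defines "S \<equiv> \<lambda>j x. \<Sum>i<j. f ((T ^^ i) x)"
  shows "0 \<le> (\<integral>x. indicator {x \<in> space M. \<exists>j\<le>n. 0 < S j x} x * f x \<partial>M)"
proof -
  define m where "m x = Max ((\<lambda>j. S j x) ` {..n})" for x
  define A where "A = {x \<in> space M. \<exists>j\<le>n. 0 < S j x}"
  have [measurable]: "f \<in> borel_measurable M" using f by auto
  have [measurable]: "S j \<in> borel_measurable M" for j unfolding S_def by measurable
  have [measurable]: "A \<in> sets M" unfolding A_def by measurable
  have S_int: "integrable M (S j)" for j
    unfolding S_def by (intro Bochner_Integration.integrable_sum integrable_funpow f)
  have m_meas [measurable]: "m \<in> borel_measurable M"
    unfolding m_def by (intro borel_measurable_Max) auto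
  have m_ge: "S j x \<le> m x" if "j \<le> n" for j x
    unfolding m_def using that by (intro Max_ge) auto
  have m_le: "m x \<le> c" if "\<And>j. j \<le> n \<Longrightarrow> S j x \<le> c" for c x
    unfolding m_def using that by (intro Max.boundedI) auto
  have m_nonneg: "0 \<le> m x" for x using m_ge[of 0 x] by (simp add: S_def)
  have m_int: "integrable M m"
  proof (rule Bochner_Integration.integrable_bound)
    show "integrable M (\<lambda>x. \<Sum>j\<le>n. \<bar>S j x\<bar>)"
      by (intro Bochner_Integration.integrable_sum integrable_abs S_int)
    have "m x \<le> (\<Sum>j\<le>n. \<bar>S j x\<bar>)" for x
    proof (rule m_le)
      fix j assume "j \<le> n"
      then have "\<bar>S j x\<bar> \<le> (\<Sum>j\<le>n. \<bar>S j x\<bar>)"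
        by (intro member_le_sum) auto
      then show "S j x \<le> (\<Sum>j\<le>n. \<bar>S j x\<bar>)" by linarith
    qed
    then show "AE x in M. norm (m x) \<le> norm (\<Sum>j\<le>n. \<bar>S j x\<bar>)"
      using m_nonneg by (intro AE_I2) (auto simp: abs_of_nonneg sum_nonneg)
  qed simp
  have S_Suc: "S (Suc j) x = f x + S j (T x)" for j x
    unfolding S_def by (subst sum.lessThan_Suc_shift) (simp add: funpow_swap1)
  have key: "m x - m (T x) \<le> indicator A x * f x" if x: "x \<in> space M" for x
  proof (cases "x \<in> A")
    case True
    then obtain j where j: "j \<le> n" "0 < S j x" by (auto simp: A_def)
    have pos: "0 < m x" using j m_ge[of j x] by linarith
    have "m x \<le> f x + m (T x)"
    proof -
      have "m x \<in> (\<lambda>j. S j x) ` {..n}" unfolding m_def by (intro Max_in) auto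
      then obtain i where i: "i \<le> n" "m x = S i x" by auto
      then have "i \<noteq> 0" using pos by (cases "i = 0") (auto simp: S_def)
      then obtain i' where "i = Suc i'" by (cases i) auto
      then show ?thesis using i m_ge[of i' "T x"] by (simp add: S_Suc)
    qed
    then show ?thesis using True by simp
  next
    case False
    then have "m x \<le> 0" using x by (intro m_le) (auto simp: A_def not_less)
    then show ?thesis using False m_nonneg[of "T x"] by simp
  qed
  have mT: "integrable M (\<lambda>x. m (T x))" "(\<integral>x. m (T x) \<partial>M) = (\<integral>x. m x \<partial>M)"
    using integrable_funpow[OF m_int, of 1] integral_funpow[OF m_meas, of 1] by simp_all
  have "0 = (\<integral>x. m x - m (T x) \<partial>M)" using mT m_int by simp
  also have "\<dots> \<le> (\<integral>x. indicator A x * f x \<partial>M)"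
    using mT m_int key integrable_mult_indicator[OF \<open>A \<in> sets M\<close> f]
    by (intro integral_mono) auto
  finally show ?thesis unfolding A_def .
qed

text \<open>Whether the partial sums are bounded above does not change from \<open>x\<close> to \<open>T x\<close>, at every point
  and not just almost surely. Ergodicity, which speaks of exactly invariant sets only, therefore
  makes unboundedness an event of probability \<open>0\<close> or \<open>1\<close>. In the second case the sets in the
  maximal inequality exhaust the space and the integral of \<open>f\<close> is nonnegative.\<close>

lemma sums_bounded_above:
  fixes f :: "'a \<Rightarrow> real"
  assumes erg: "\<And>A. A \<in> sets M \<Longrightarrow> T -` A \<inter> space M = A \<Longrightarrow> prob A \<in> {0, 1}"
    and f: "integrable M f" and neg: "(\<integral>x. f x \<partial>M) < 0"
  shows "AE x in M. bdd_above (range (\<lambda>n. \<Sum>i<n. f ((T ^^ i) x)))"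
proof -
  define S where "S j x = (\<Sum>i<j. f ((T ^^ i) x))" for j x
  have [measurable]: "f \<in> borel_measurable M" using f by auto
  have [measurable]: "S j \<in> borel_measurable M" for j unfolding S_def by measurable
  define D where "D = {x \<in> space M. \<forall>c::nat. \<exists>n. real c < S n x}"
  have [measurable]: "D \<in> sets M" unfolding D_def by measurable
  have S_Suc: "S (Suc j) x = f x + S j (T x)" for j x
    unfolding S_def by (subst sum.lessThan_Suc_shift) (simp add: funpow_swap1)
  have D_iff: "x \<in> D \<longleftrightarrow> x \<in> space M \<and> \<not> bdd_above (range (\<lambda>n. S n x))" for x
  proof -
    have "(\<forall>c::nat. \<exists>n. real c < S n x) \<longleftrightarrow> (\<forall>c. \<exists>n. c < S n x)"
      by (meson less_trans reals_Archimedean2)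
    then show ?thesis by (auto simp: D_def bdd_above_def not_le)
  qed
  have inv: "bdd_above (range (\<lambda>n. S n (T x))) \<longleftrightarrow> bdd_above (range (\<lambda>n. S n x))" for x
  proof
    assume "bdd_above (range (\<lambda>n. S n (T x)))"
    then obtain c where c: "\<And>n. S n (T x) \<le> c" by (auto simp: bdd_above_def)
    have "S n x \<le> max 0 (f x + c)" for n
      using c by (cases n) (auto simp: S_Suc le_max_iff_disj, auto simp: S_def)
    then show "bdd_above (range (\<lambda>n. S n x))" by (auto simp: bdd_above_def)
  next
    assume "bdd_above (range (\<lambda>n. S n x))"
    then obtain c where c: "\<And>n. S n x \<le> c" by (auto simp: bdd_above_def)
    have "S n (T x) \<le> c - f x" for n using c[of "Suc n"] by (simp add: S_Suc)
    then show "bdd_above (range (\<lambda>n. S n (T x)))" by (auto simp: bdd_above_def)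
  qed
  have "T -` D \<inter> space M = D"
    using measurable_space[OF T_measurable] by (auto simp: D_iff inv)
  then have "prob D = 0 \<or> prob D = 1" using erg[of D] by auto
  moreover have "prob D \<noteq> 1"
  proof
    assume "prob D = 1"
    then have D1: "AE x in M. x \<in> D" by (simp add: prob_eq_1)
    define A where "A n = {x \<in> space M. \<exists>j\<le>n. 0 < S j x}" for n :: nat
    have [measurable]: "A n \<in> sets M" for n unfolding A_def by measurable
    have "(\<lambda>n. \<integral>x. indicator (A n) x * f x \<partial>M) \<longlonglongrightarrow> (\<integral>x. f x \<partial>M)"
    proof (rule integral_dominated_convergence[where w = "\<lambda>x. \<bar>f x\<bar>"])
      show "AE x in M. (\<lambda>n. indicator (A n) x * f x) \<longlonglongrightarrow> f x"
        using D1
      proof eventually_elim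
        case (elim x)
        then obtain j where j: "x \<in> space M" "0 < S j x"
          by (auto simp: D_def dest: spec[of _ 0])
        have "\<forall>\<^sub>F n in sequentially. indicator (A n) x * f x = f x"
          using eventually_ge_at_top[of j] by eventually_elim (use j in \<open>auto simp: A_def indicator_def\<close>)
        then show ?case by (rule tendsto_eventually)
      qed
    qed (use f in \<open>auto simp: abs_mult indicator_def\<close>)
    moreover have "0 \<le> (\<integral>x. indicator (A n) x * f x \<partial>M)" for n
      unfolding A_def S_def by (rule maximal_ergodic[OF f])
    ultimately have "0 \<le> (\<integral>x. f x \<partial>M)" by (intro LIMSEQ_le_const) auto
    then show False using neg by simp
  qed
  ultimately have "AE x in M. x \<notin> D" by (simp add: prob_eq_0)
  with AE_space show ?thesis by eventually_elim (auto simp: D_iff S_def)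
qed

text \<open>The previous lemma for \<open>f - b\<close>, with \<open>b\<close> strictly between the mean and \<open>a\<close>: the excess of the
  sums over \<open>n b\<close> stays bounded, while \<open>(a - b) n\<close> does not.\<close>

lemma ergodic_average_upper:
  fixes f :: "'a \<Rightarrow> real"
  assumes erg: "\<And>A. A \<in> sets M \<Longrightarrow> T -` A \<inter> space M = A \<Longrightarrow> prob A \<in> {0, 1}"
    and f: "integrable M f" and a: "(\<integral>x. f x \<partial>M) < a"
  shows "AE x in M. \<forall>\<^sub>F n in sequentially. (\<Sum>i<n. f ((T ^^ i) x)) / real n < a"
proof -
  obtain b where b: "(\<integral>x. f x \<partial>M) < b" "b < a" using a dense by blast
  have "AE x in M. bdd_above (range (\<lambda>n. \<Sum>i<n. f ((T ^^ i) x) - b))"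
    by (rule sums_bounded_above[OF erg])
       (use f b in \<open>auto simp: prob_space\<close>)
  then show ?thesis
  proof eventually_elim
    case (elim x)
    then obtain c where c: "\<And>n. (\<Sum>i<n. f ((T ^^ i) x) - b) \<le> c" by (auto simp: bdd_above_def)
    have "\<forall>\<^sub>F n in sequentially. c < (a - b) * real n"
      using b by real_asymp
    then show ?case
      using eventually_gt_at_top[of 0]
    proof eventually_elim
      case (elim n)
      then show ?case using c[of n] by (simp add: sum_subtractf field_simps)
    qed
  qed
qed

theorem birkhoff:
  fixes f :: "'a \<Rightarrow> real"
  assumes erg: "\<And>A. A \<in> sets M \<Longrightarrow> T -` A \<inter> space M = A \<Longrightarrow> prob A \<in> {0, 1}"
    and f: "integrable M f"
  shows "AE x in M. (\<lambda>n. (\<Sum>i<n. f ((T ^^ i) x)) / real n) \<longlonglongrightarrow> (\<integral>x. f x \<partial>M)"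
proof -
  let ?I = "\<integral>x. f x \<partial>M"
  have up: "AE x in M. \<forall>m::nat. \<forall>\<^sub>F n in sequentially. (\<Sum>i<n. f ((T ^^ i) x)) / real n < ?I + 1 / Suc m"
    unfolding AE_all_countable by (intro allI ergodic_average_upper erg f) auto
  have "AE x in M. \<forall>m::nat. \<forall>\<^sub>F n in sequentially. (\<Sum>i<n. - f ((T ^^ i) x)) / real n < - ?I + 1 / Suc m"
    unfolding AE_all_countable
    by (intro allI ergodic_average_upper[where f = "\<lambda>x. - f x"] erg) (use f in auto)
  with up show ?thesis
  proof eventually_elim
    case (elim x)
    show ?case
    proof (rule LIMSEQ_I)
      fix r :: real assume "r > 0"
      then obtain m :: nat where m: "1 / Suc m < r" using nat_approx_posE by blast
      show "\<exists>n0. \<forall>n\<ge>n0. norm ((\<Sum>i<n. f ((T ^^ i) x)) / real n - ?I) < r"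
        unfolding eventually_sequentially[symmetric]
        using elim(1)[rule_format, of m] elim(2)[rule_format, of m]
      proof eventually_elim
        case (elim n)
        then show ?case using m by (simp add: sum_negf abs_less_iff)
      qed
    qed
  qed
qed

corollary ergodic_theorem_L1:
  fixes f :: "'a \<Rightarrow> real"
  assumes erg: "\<And>A. A \<in> sets M \<Longrightarrow> T -` A \<inter> space M = A \<Longrightarrow> prob A \<in> {0, 1}"
    and f [measurable]: "f \<in> borel_measurable M" and bound: "AE x in M. \<bar>f x\<bar> \<le> C"
  shows "(\<lambda>n. \<integral>x. \<bar>(\<Sum>i<n. f ((T ^^ i) x)) / real n - (\<integral>x. f x \<partial>M)\<bar> \<partial>M) \<longlonglongrightarrow> 0"
proof -
  let ?I = "\<integral>x. f x \<partial>M"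
  have int: "integrable M f" using bound by (intro integrable_const_bound[of _ C]) auto
  have "AE x in M. \<forall>i. \<bar>f ((T ^^ i) x)\<bar> \<le> C"
    unfolding AE_all_countable by (intro allI AE_funpow bound)
  then have bd: "AE x in M. \<forall>n. \<bar>(\<Sum>i<n. f ((T ^^ i) x)) / real n\<bar> \<le> \<bar>C\<bar>"
  proof eventually_elim
    case (elim x)
    show ?case
    proof
      fix n
      have "\<bar>\<Sum>i<n. f ((T ^^ i) x)\<bar> \<le> (\<Sum>i<n. \<bar>C\<bar>)"
        using elim by (intro order_trans[OF sum_abs] sum_mono) (meson abs_ge_self order_trans)
      then show "\<bar>(\<Sum>i<n. f ((T ^^ i) x)) / real n\<bar> \<le> \<bar>C\<bar>"
        by (cases "n = 0") (auto simp: field_simps)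
    qed
  qed
  have lim: "AE x in M. (\<lambda>n. (\<Sum>i<n. f ((T ^^ i) x)) / real n) \<longlonglongrightarrow> ?I"
    by (rule birkhoff[where f = f, OF _ int]) (rule erg)
  have "(\<lambda>n. \<integral>x. \<bar>(\<Sum>i<n. f ((T ^^ i) x)) / real n - ?I\<bar> \<partial>M) \<longlonglongrightarrow> (\<integral>x. 0 \<partial>M)"
  proof (rule integral_dominated_convergence[where w = "\<lambda>_. \<bar>C\<bar> + \<bar>?I\<bar>"])
    show "AE x in M. (\<lambda>n. \<bar>(\<Sum>i<n. f ((T ^^ i) x)) / real n - ?I\<bar>) \<longlonglongrightarrow> 0"
      using lim by eventually_elim (simp add: tendsto_rabs_zero_iff LIM_zero_iff)
    show "AE x in M. norm \<bar>(\<Sum>i<n. f ((T ^^ i) x)) / real n - ?I\<bar> \<le> \<bar>C\<bar> + \<bar>?I\<bar>" for n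
      using bd
    proof eventually_elim
      case (elim x)
      then have "\<bar>(\<Sum>i<n. f ((T ^^ i) x)) / real n\<bar> \<le> \<bar>C\<bar>" by blast
      then show ?case unfolding real_norm_def by linarith
    qed
  qed auto
  then show ?thesis by simp
qed

end

section \<open>Finite fields and words\<close>

lemma algebra_generated_by_intervals:
  assumes "generated_by_intervals B"
  shows "algebra UNIV B"
proof -
  obtain I where B: "B = algebra UNIV hull I"
    using assms by (auto simp: generated_by_intervals_def)
  have mem: "a \<in> B \<longleftrightarrow> (\<forall>F. algebra UNIV F \<longrightarrow> I \<subseteq> F \<longrightarrow> a \<in> F)" for a
    unfolding B hull_def by blast
  show ?thesis
    unfolding algebra_iff_Un
  proof (intro conjI ballI)
    show "B \<subseteq> Pow UNIV" by simp
    show "{} \<in> B" unfolding mem by (simp add: algebra_iff_Un)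
    show "UNIV - a \<in> B" if "a \<in> B" for a
      using that unfolding mem algebra_iff_Un by metis
    show "a \<union> b \<in> B" if "a \<in> B" "b \<in> B" for a b
      using that unfolding mem algebra_iff_Un by metis
  qed
qed

text \<open>In a finite field the intersection of all members that contain \<open>x\<close> is a member, and it is the
  only atom that contains \<open>x\<close>; this makes the definite description in \<open>cell\<close> meaningful.\<close>

lemma cell:
  assumes "algebra UNIV B" "finite B"
  shows cell_in_atoms: "cell B x \<in> atoms B"
    and mem_cell: "x \<in> cell B x"
    and cell_subset: "\<And>A. A \<in> B \<Longrightarrow> x \<in> A \<Longrightarrow> cell B x \<subseteq> A"
proof -
  interpret algebra UNIV B by fact
  define S where "S = {A \<in> B. x \<in> A}"
  define C where "C = \<Inter>S"
  have "finite S" "S \<noteq> {}" "S \<subseteq> B" using \<open>finite B\<close> top unfolding S_def by auto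
  then have C_B: "C \<in> B"
    using finite_INT[of S "\<lambda>A. A"] unfolding C_def by auto
  have x: "x \<in> C" by (simp add: C_def S_def)
  have min: "C \<subseteq> A" if "A \<in> B" "x \<in> A" for A
    using that unfolding C_def S_def by blast
  have "D = {} \<or> D = C" if D: "D \<in> B" "D \<subseteq> C" for D
  proof (cases "x \<in> D")
    case True
    then show ?thesis using min[OF D(1)] D(2) by blast
  next
    case False
    have "C - D \<in> B" using C_B D(1) by (rule Diff)
    then have "C \<subseteq> C - D" using x False by (intro min) blast+
    then show ?thesis using D by blast
  qed
  then have C: "C \<in> atoms B" using C_B x unfolding atoms_def by blast
  have uniq: "A = C" if A: "A \<in> atoms B" "x \<in> A" for A
  proof -
    have A_B: "A \<in> B" using A by (simp add: atoms_def)
    then have "A \<inter> C \<in> B" using C_B by (rule Int)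
    moreover have "A \<inter> C \<noteq> {}" using A(2) x by auto
    moreover have "\<forall>D\<in>B. D \<subseteq> A \<longrightarrow> D = {} \<or> D = A" using A(1) by (simp add: atoms_def)
    ultimately have "A \<inter> C = A" by (metis Int_lower1)
    then show ?thesis using min[OF A_B A(2)] by blast
  qed
  have "cell B x = C"
    unfolding cell_def by (rule the_equality) (use C x uniq in blast)+
  then show "cell B x \<in> atoms B" "x \<in> cell B x"
      "\<And>A. A \<in> B \<Longrightarrow> x \<in> A \<Longrightarrow> cell B x \<subseteq> A"
    using C x min by blast+
qed

lemma cell_eq_atom_iff:
  assumes "algebra UNIV B" "finite B" "A \<in> atoms B"
  shows "cell B x = A \<longleftrightarrow> x \<in> A"
proof
  show "cell B x = A \<Longrightarrow> x \<in> A" using mem_cell[OF assms(1,2), of x] by simp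
  assume "x \<in> A"
  then have "cell B x \<subseteq> A"
    using cell_subset[OF assms(1,2), of A x] assms(3) by (simp add: atoms_def)
  moreover have "cell B x \<in> B" "cell B x \<noteq> {}"
    using cell_in_atoms[OF assms(1,2), of x] by (simp_all add: atoms_def)
  ultimately show "cell B x = A" using assms(3) unfolding atoms_def by blast
qed

lemma cell_eq_iff:
  assumes "algebra UNIV B" "finite B"
  shows "cell B x = cell B y \<longleftrightarrow> (\<forall>A\<in>B. x \<in> A \<longleftrightarrow> y \<in> A)"
proof
  assume "cell B x = cell B y"
  then show "\<forall>A\<in>B. x \<in> A \<longleftrightarrow> y \<in> A"
    using cell_subset[OF assms] mem_cell[OF assms] by blast
next
  assume *: "\<forall>A\<in>B. x \<in> A \<longleftrightarrow> y \<in> A"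
  have "cell B y \<in> atoms B" by (rule cell_in_atoms[OF assms])
  moreover from this have "x \<in> cell B y" using * mem_cell[OF assms, of y] by (simp add: atoms_def)
  ultimately show "cell B x = cell B y" by (simp add: cell_eq_atom_iff[OF assms])
qed

definition word :: "real set set \<Rightarrow> nat \<Rightarrow> (int \<Rightarrow> real) \<Rightarrow> nat \<Rightarrow> real set" where
  "word B l x = (\<lambda>i\<in>{1..l}. cell B (x (- int i)))"

lemma word_eq_iff: "word B l x = word B l y \<longleftrightarrow> (\<forall>i\<in>{1..l}. cell B (x (- int i)) = cell B (y (- int i)))"
  unfolding word_def by (auto simp: restrict_def fun_eq_iff)

text \<open>The information in the words grows with the field and with the length, so a function of a word
  stays a function of all later words.\<close>

lemma word_refine:
  assumes "algebra UNIV B" "finite B" "algebra UNIV B'" "finite B'" "B \<subseteq> B'" "l \<le> l'"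
    and "word B' l' x = word B' l' y"
  shows "word B l x = word B l y"
proof -
  have "cell B a = cell B b" if "cell B' a = cell B' b" for a b
    using that assms(5) unfolding cell_eq_iff[OF assms(1,2)] cell_eq_iff[OF assms(3,4)] by blast
  moreover have "{1..l} \<subseteq> {1..l'}" using assms(6) by auto
  ultimately show ?thesis using assms(7) unfolding word_eq_iff by blast
qed

abbreviation words :: "real set set \<Rightarrow> nat \<Rightarrow> (nat \<Rightarrow> real set) set" where
  "words B l \<equiv> {1..l} \<rightarrow>\<^sub>E atoms B"

lemma finite_atoms: "finite B \<Longrightarrow> finite (atoms B)"
  by (auto simp: atoms_def)

lemma measurable_word:
  assumes B: "algebra UNIV B" "finite B" "B \<subseteq> sets borel"
    and coord: "\<And>i. i \<ge> 1 \<Longrightarrow> (\<lambda>x. x (- int i)) \<in> borel_measurable N"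
  shows "word B l \<in> N \<rightarrow>\<^sub>M count_space (words B l)"
proof -
  have "word B l -` {w} \<inter> space N \<in> sets N" if w: "w \<in> words B l" for w
  proof -
    have "word B l x = w \<longleftrightarrow> (\<forall>i\<in>{1..l}. x (- int i) \<in> w i)" for x
    proof -
      have "word B l x = w \<longleftrightarrow> (\<forall>i\<in>{1..l}. cell B (x (- int i)) = w i)"
        using w by (auto simp: word_def fun_eq_iff PiE_def extensional_def)
      also have "\<dots> \<longleftrightarrow> (\<forall>i\<in>{1..l}. x (- int i) \<in> w i)"
        using w by (intro ball_cong refl cell_eq_atom_iff B) auto
      finally show ?thesis .
    qed
    then have "word B l -` {w} \<inter> space N = {x \<in> space N. \<forall>i\<in>{1..l}. x (- int i) \<in> w i}"
      by auto
    also have "\<dots> \<in> sets N"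
    proof (intro sets.sets_Collect_finite_All)
      fix i assume i: "i \<in> {1..l}"
      then have [measurable]: "w i \<in> sets borel" using w B by (auto simp: atoms_def)
      have [measurable]: "(\<lambda>x. x (- int i)) \<in> borel_measurable N" using i by (intro coord) auto
      show "{x \<in> space N. x (- int i) \<in> w i} \<in> sets N" by measurable
    qed auto
    finally show ?thesis .
  qed
  then show ?thesis
    using B by (subst measurable_count_space_eq2)
      (auto intro!: finite_PiE finite_atoms cell_in_atoms simp: word_def)
qed

section \<open>The return map\<close>

lemma enat_less_Inf_iff: "enat t < Inf {enat s |s. p s} \<longleftrightarrow> (\<forall>s\<le>t. \<not> p s)"
proof
  assume less: "enat t < Inf {enat s |s. p s}"
  show "\<forall>s\<le>t. \<not> p s"
  proof (intro allI impI notI)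
    fix s assume s: "s \<le> t" "p s"
    then have "Inf {enat s |s. p s} \<le> enat s" by (intro Inf_lower) blast
    with less have "enat t < enat s" by (rule less_le_trans)
    with s show False by simp
  qed
next
  assume none: "\<forall>s\<le>t. \<not> p s"
  have "enat (Suc t) \<le> Inf {enat s |s. p s}"
  proof (rule Inf_greatest)
    fix a assume "a \<in> {enat s |s. p s}"
    then obtain s where s: "a = enat s" "p s" by blast
    then have "\<not> s \<le> t" using none by blast
    then show "enat (Suc t) \<le> a" by (simp add: s)
  qed
  then show "enat t < Inf {enat s |s. p s}"
    by (meson enat_ord_simps(2) lessI less_le_trans)
qed

lemma enat_Inf_eq_iff: "Inf {enat s |s. p s} = enat t \<longleftrightarrow> p t \<and> (\<forall>s<t. \<not> p s)"
proof
  assume eq: "Inf {enat s |s. p s} = enat t"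
  have below: "\<not> p s" if "s < t" for s
  proof
    assume "p s"
    then have "Inf {enat s |s. p s} \<le> enat s" by (intro Inf_lower) blast
    with that show False by (simp add: eq)
  qed
  have "p t"
  proof (rule ccontr)
    assume "\<not> p t"
    then have "\<forall>s\<le>t. \<not> p s" using below le_neq_implies_less by blast
    then have "enat t < Inf {enat s |s. p s}" by (simp only: enat_less_Inf_iff)
    then show False by (simp add: eq)
  qed
  then show "p t \<and> (\<forall>s<t. \<not> p s)" using below by blast
next
  assume t: "p t \<and> (\<forall>s<t. \<not> p s)"
  show "Inf {enat s |s. p s} = enat t"
  proof (rule antisym)
    show "Inf {enat s |s. p s} \<le> enat t" using t by (intro Inf_lower) blast
    show "enat t \<le> Inf {enat s |s. p s}"
    proof (rule Inf_greatest)
      fix a assume "a \<in> {enat s |s. p s}"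
      then obtain s where s: "a = enat s" "p s" by blast
      then have "\<not> s < t" using t by blast
      then show "enat t \<le> a" by (simp add: s)
    qed
  qed
qed

definition rewind :: "nat \<Rightarrow> (int \<Rightarrow> real) \<Rightarrow> int \<Rightarrow> real" where
  "rewind t x = (\<lambda>i. x (i - int t))"

lemma rewind_rewind: "rewind s (rewind t x) = rewind (s + t) x"
  by (auto simp: rewind_def algebra_simps)

lemma rewind_0 [simp]: "rewind 0 x = x" by (simp add: rewind_def)

lemma funpow_shift: "(shift ^^ t) x = (\<lambda>i. x (i + int t))"
  by (induction t) (auto simp: shift_def algebra_simps)

lemma rewind_funpow_shift: "s \<le> t \<Longrightarrow> rewind s ((shift ^^ t) x) = (shift ^^ (t - s)) x"
  by (auto simp: rewind_def funpow_shift of_nat_diff algebra_simps)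

definition return_time :: "((int \<Rightarrow> real) \<Rightarrow> 'b) \<Rightarrow> (int \<Rightarrow> real) \<Rightarrow> enat" where
  "return_time W x = Inf {enat t |t. 0 < t \<and> W (rewind t x) = W x}"

text \<open>The identity fills the null event of no earlier occurrence, so that the label is preserved
  without exception.\<close>

definition return_map :: "((int \<Rightarrow> real) \<Rightarrow> 'b) \<Rightarrow> (int \<Rightarrow> real) \<Rightarrow> int \<Rightarrow> real" where
  "return_map W x = (case return_time W x of enat t \<Rightarrow> rewind t x | \<infinity> \<Rightarrow> x)"

lemma return_time_eq_iff:
  "return_time W x = enat t \<longleftrightarrow>
     0 < t \<and> W (rewind t x) = W x \<and> (\<forall>s<t. 0 < s \<longrightarrow> W (rewind s x) \<noteq> W x)"
  unfolding return_time_def enat_Inf_eq_iff by auto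

lemma less_return_time_iff:
  "enat t < return_time W x \<longleftrightarrow> (\<forall>s\<in>{1..t}. W (rewind s x) \<noteq> W x)"
  unfolding return_time_def enat_less_Inf_iff by auto

lemma label_return_map [simp]: "W (return_map W x) = W x"
  by (auto simp: return_map_def return_time_eq_iff split: enat.split)

lemma label_funpow_return_map [simp]: "W ((return_map W ^^ j) x) = W x"
  by (induction j) auto

lemma space_past_algebra [simp]: "space (past_algebra M X) = space M"
  by (simp add: past_algebra_def)

lemma coord_past_algebra:
  assumes "i < 0"
  shows "X i \<in> borel_measurable (past_algebra M X)"
proof -
  have "(\<lambda>\<omega>. (\<lambda>t\<in>{..<0}. X t \<omega>) i) \<in> borel_measurable (past_algebra M X)"
    unfolding past_algebra_def
    using assms
    by (intro measurable_compose[OF measurable_vimage_algebra1 measurable_component_singleton])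
       (auto simp: space_PiM PiE_def extensional_def)
  then show ?thesis using assms by simp
qed

lemma subalgebra_past_algebra:
  assumes "\<And>t. X t \<in> borel_measurable M"
  shows "subalgebra M (past_algebra M X)"
  unfolding subalgebra_def
proof (intro conjI subsetI)
  fix A assume A: "A \<in> sets (past_algebra M X)"
  have id: "(\<lambda>\<omega>. \<omega>) \<in> M \<rightarrow>\<^sub>M past_algebra M X"
    unfolding past_algebra_def
    by (rule measurable_vimage_algebra2) (auto intro!: measurable_restrict assms)
  have "A \<subseteq> space M" using sets.sets_into_space[OF A] by simp
  then show "A \<in> sets M" using measurable_sets[OF id A] by (simp add: Int_absorb2)
qed simp

abbreviation past_of :: "(int \<Rightarrow> real) measure \<Rightarrow> (int \<Rightarrow> real) measure" where
  "past_of P \<equiv> past_algebra P (\<lambda>t x. x t)"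

locale stationary_paths = prob_space P for P :: "(int \<Rightarrow> real) measure" +
  assumes sets_P [measurable_cong]: "sets P = sets (Pi\<^sub>M UNIV (\<lambda>_. borel))"
    and distr_shift: "distr P P shift = P"
begin

lemma space_P [simp]: "space P = UNIV"
  using sets_eq_imp_space_eq[OF sets_P] by (simp add: space_PiM)

lemma coord_measurable [measurable]: "(\<lambda>x. x i) \<in> borel_measurable P"
  by (subst measurable_cong_sets[OF sets_P refl]) (rule measurable_component_singleton, simp)

lemma measurable_pathsI:
  assumes "\<And>i. (\<lambda>x. f x i) \<in> borel_measurable N"
  shows "f \<in> N \<rightarrow>\<^sub>M P"
  by (subst measurable_cong_sets[OF refl sets_P], rule measurable_PiM_single') (use assms in auto)

lemma rewind_measurable [measurable]: "rewind t \<in> P \<rightarrow>\<^sub>M P"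
  by (rule measurable_pathsI) (simp add: rewind_def)

lemma shift_measurable [measurable]: "shift \<in> P \<rightarrow>\<^sub>M P"
  by (rule measurable_pathsI) (simp add: shift_def)

sublocale measure_preserving P shift
  by unfold_locales (auto simp: distr_shift)

lemma emeasure_funpow_shift:
  assumes [measurable]: "A \<in> sets P"
  shows "emeasure P {x. (shift ^^ t) x \<in> A} = emeasure P A"
proof -
  have "emeasure P A = emeasure (distr P P (shift ^^ t)) A" by (simp only: distr_funpow)
  also have "\<dots> = emeasure P {x. (shift ^^ t) x \<in> A}"
    by (subst emeasure_distr) (auto simp: vimage_def)
  finally show ?thesis ..
qed

lemma coord_past_measurable: "i < 0 \<Longrightarrow> (\<lambda>x. x i) \<in> borel_measurable (past_of P)"
  by (rule coord_past_algebra)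

lemma measurable_pastI:
  assumes "\<And>i. i < 0 \<Longrightarrow> (\<lambda>x. f x i) \<in> borel_measurable N"
  shows "f \<in> N \<rightarrow>\<^sub>M past_of P"
  unfolding past_algebra_def
  by (rule measurable_vimage_algebra2) (auto intro!: measurable_restrict assms)

lemma subalgebra_past: "subalgebra P (past_of P)"
  by (rule subalgebra_past_algebra) (rule coord_measurable)

lemma rewind_past_measurable: "rewind t \<in> past_of P \<rightarrow>\<^sub>M past_of P"
  by (rule measurable_pastI) (auto simp: rewind_def intro!: coord_past_measurable)

end

locale labelled_paths = stationary_paths P for P +
  fixes W :: "(int \<Rightarrow> real) \<Rightarrow> 'b" and R :: "'b set"
  assumes finite_R: "finite R"
    and W_past: "W \<in> past_of P \<rightarrow>\<^sub>M count_space R"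
begin

abbreviation "\<tau> \<equiv> return_time W"
abbreviation "\<theta> \<equiv> return_map W"

lemma W_in_R: "W x \<in> R"
  using measurable_space[OF W_past] by simp

text \<open>The label is a function of the past, hence so are the return time and the past of the returned
  path. This is what makes the innovations along return times orthogonal below.\<close>

lemma recurs_past: "{x. W (rewind t x) = W x} \<in> sets (past_of P)"
proof -
  have "{x. W (rewind t x) = W x} =
      (\<Union>w\<in>R. (\<lambda>x. W (rewind t x)) -` {w} \<inter> space (past_of P) \<inter> (W -` {w} \<inter> space (past_of P)))"
    using W_in_R by auto
  also have "\<dots> \<in> sets (past_of P)"
    using finite_R
    by (intro sets.finite_UN sets.Int measurable_sets[OF measurable_compose[OF rewind_past_measurable W_past]]
      measurable_sets[OF W_past]) auto
  finally show ?thesis .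
qed

lemma return_time_past: "\<tau> \<in> past_of P \<rightarrow>\<^sub>M count_space UNIV"
proof -
  have [measurable]: "Measurable.pred (past_of P) (\<lambda>x. W (rewind t x) = W x)" for t
    using recurs_past[of t] by (simp add: pred_def)
  have fin: "{x. \<tau> x = enat t} \<in> sets (past_of P)" for t
  proof -
    have "{x \<in> space (past_of P). 0 < t \<and> W (rewind t x) = W x \<and> (\<forall>s<t. 0 < s \<longrightarrow> W (rewind s x) \<noteq> W x)}
        \<in> sets (past_of P)"
      by measurable
    then show ?thesis by (simp add: return_time_eq_iff)
  qed
  have "{x. \<tau> x = n} \<in> sets (past_of P)" for n
  proof (cases n)
    case infinity
    have "\<tau> x = n \<longleftrightarrow> (\<forall>t. \<tau> x \<noteq> enat t)" for x
      unfolding infinity by (cases "\<tau> x") auto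
    then have "{x. \<tau> x = n} = space (past_of P) - (\<Union>t. {x. \<tau> x = enat t})"
      by auto
    moreover have "(\<Union>t. {x. \<tau> x = enat t}) \<in> sets (past_of P)"
      using fin by (intro sets.countable_UN) auto
    ultimately show ?thesis using sets.compl_sets by metis
  qed (use fin in simp)
  then show ?thesis
    by (subst measurable_count_space_eq2_countable) (auto simp: vimage_def)
qed

lemma return_time_measurable [measurable]: "\<tau> \<in> P \<rightarrow>\<^sub>M count_space UNIV"
  by (rule measurable_from_subalg[OF subalgebra_past return_time_past])

lemma W_measurable [measurable]: "W \<in> P \<rightarrow>\<^sub>M count_space R"
  by (rule measurable_from_subalg[OF subalgebra_past W_past])

lemma return_map_coord:
  "\<theta> x i = (case \<tau> x of enat t \<Rightarrow> x (i - int t) | \<infinity> \<Rightarrow> x i)"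
  by (simp add: return_map_def rewind_def split: enat.split)

lemma return_map_measurable [measurable]: "\<theta> \<in> P \<rightarrow>\<^sub>M P"
proof (rule measurable_pathsI)
  fix i
  have "(\<lambda>x. (\<lambda>n x. case n of enat t \<Rightarrow> x (i - int t) | \<infinity> \<Rightarrow> x i) (\<tau> x) x) \<in> borel_measurable P"
    by (rule measurable_compose_countable[OF _ return_time_measurable]) (auto split: enat.split)
  then show "(\<lambda>x. \<theta> x i) \<in> borel_measurable P" unfolding return_map_coord .
qed

lemma return_map_past: "\<theta> \<in> past_of P \<rightarrow>\<^sub>M past_of P"
proof (rule measurable_pastI)
  fix i :: int assume "i < 0"
  have "(\<lambda>x. case n of enat t \<Rightarrow> x (i - int t) | \<infinity> \<Rightarrow> x i) \<in> borel_measurable (past_of P)"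
    for n :: enat
    using \<open>i < 0\<close> by (cases n) (simp_all add: coord_past_measurable)
  then have "(\<lambda>x. (\<lambda>n x. case n of enat t \<Rightarrow> x (i - int t) | \<infinity> \<Rightarrow> x i) (\<tau> x) x) \<in> borel_measurable (past_of P)"
    by (rule measurable_compose_countable[OF _ return_time_past])
  then show "(\<lambda>x. \<theta> x i) \<in> borel_measurable (past_of P)" unfolding return_map_coord .
qed

text \<open>Fix a label \<open>w\<close>. The event that \<open>w\<close> is seen now and was not seen at the \<open>t\<close> instants
  before has, by stationarity, the probability of the event that \<open>w\<close> is first seen at time \<open>t\<close>.
  These are disjoint for different \<open>t\<close>, so their probabilities add up to at most \<open>1\<close>. Summation
  over \<open>t\<close> gives the contribution of \<open>w\<close> to the expected return time. Finiteness of the return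
  time (recurrence) comes for free.\<close>

theorem kac: "(\<integral>\<^sup>+x. ennreal_of_enat (\<tau> x) \<partial>P) \<le> of_nat (card R)"
proof -
  define E where "E w t = {x. W x = w \<and> (\<forall>s\<in>{1..t}. W (rewind s x) \<noteq> w)}" for w t
  define D where "D w t = {x. (shift ^^ t) x \<in> E w t}" for w t
  have E_meas [measurable]: "E w t \<in> sets P" if "w \<in> R" for w t
  proof -
    have "{x \<in> space P. W x = w \<and> (\<forall>s\<in>{1..t}. W (rewind s x) \<noteq> w)} \<in> sets P"
      using that by measurable
    then show ?thesis by (simp add: E_def)
  qed
  have D_iff: "x \<in> D w t \<longleftrightarrow> W ((shift ^^ t) x) = w \<and> (\<forall>s<t. W ((shift ^^ s) x) \<noteq> w)" for x w t
  proof -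
    have "(\<forall>s\<in>{1..t}. W ((shift ^^ (t - s)) x) \<noteq> w) \<longleftrightarrow> (\<forall>s<t. W ((shift ^^ s) x) \<noteq> w)"
    proof (intro iffI allI impI ballI)
      fix s assume "\<forall>s\<in>{1..t}. W ((shift ^^ (t - s)) x) \<noteq> w" "s < t"
      then show "W ((shift ^^ s) x) \<noteq> w" by (auto dest!: bspec[of _ _ "t - s"])
    qed auto
    then show ?thesis by (auto simp: D_def E_def rewind_funpow_shift)
  qed
  have D_meas [measurable]: "D w t \<in> sets P" if "w \<in> R" for w t
  proof -
    have "{x \<in> space P. (shift ^^ t) x \<in> E w t} \<in> sets P" using that by measurable
    then show ?thesis by (simp add: D_def)
  qed
  have sum_le: "(\<Sum>t. emeasure P (E w t)) \<le> 1" if w: "w \<in> R" for w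
  proof -
    have "disjoint_family (D w)"
    proof (unfold disjoint_family_on_def, intro ballI impI equals0I)
      fix s t x assume st: "s \<noteq> t" "x \<in> D w s \<inter> D w t"
      then have "x \<in> D w s" "x \<in> D w t" by auto
      then show False using st(1) unfolding D_iff by (metis linorder_neqE_nat)
    qed
    then have "(\<Sum>t. emeasure P (D w t)) = emeasure P (\<Union>t. D w t)"
      using w by (intro suminf_emeasure) auto
    moreover have "emeasure P (D w t) = emeasure P (E w t)" for t
      unfolding D_def using w by (intro emeasure_funpow_shift) auto
    ultimately show ?thesis by (simp add: emeasure_le_1)
  qed
  have "(\<integral>\<^sup>+x. ennreal_of_enat (\<tau> x) \<partial>P) = (\<Sum>t. emeasure P {x \<in> space P. enat t < \<tau> x})"
    using nn_integral_enat_function[OF return_time_measurable] by simp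
  also have "\<dots> = (\<Sum>t. \<Sum>w\<in>R. emeasure P (E w t))"
  proof (intro suminf_cong)
    fix t
    have "{x \<in> space P. enat t < \<tau> x} = (\<Union>w\<in>R. E w t)"
      using W_in_R by (auto simp: less_return_time_iff E_def)
    also have "emeasure P \<dots> = (\<Sum>w\<in>R. emeasure P (E w t))"
      using finite_R E_meas
      by (intro sum_emeasure[symmetric]) (auto simp: disjoint_family_on_def E_def)
    finally show "emeasure P {x \<in> space P. enat t < \<tau> x} = (\<Sum>w\<in>R. emeasure P (E w t))" .
  qed
  also have "\<dots> = (\<Sum>w\<in>R. \<Sum>t. emeasure P (E w t))"
    by (intro suminf_sum) auto
  also have "\<dots> \<le> (\<Sum>w\<in>R. 1)" by (intro sum_mono sum_le)
  finally show ?thesis by simp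
qed

lemma return_time_finite: "AE x in P. \<tau> x \<noteq> \<infinity>"
proof -
  have "AE x in P. ennreal_of_enat (\<tau> x) \<noteq> \<infinity>"
  proof (rule nn_integral_noteq_infinite)
    show "(\<lambda>x. ennreal_of_enat (\<tau> x)) \<in> borel_measurable P" by measurable
    have "(\<integral>\<^sup>+x. ennreal_of_enat (\<tau> x) \<partial>P) < \<infinity>"
      using kac by (rule le_less_trans) (simp add: of_nat_less_top)
    then show "(\<integral>\<^sup>+x. ennreal_of_enat (\<tau> x) \<partial>P) \<noteq> \<infinity>" by simp
  qed
  then show ?thesis by eventually_elim (metis ennreal_of_enat_infty)
qed

text \<open>On \<open>\<tau> = t\<close> the return map is the shift by \<open>- t\<close>. Moving that event forward by \<open>t\<close> turns it
  into the event \<open>G t\<close> that the label seen now recurs for the first time after \<open>t\<close> steps. The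
  \<open>G t\<close> are disjoint, and they exhaust the space because their total probability is that of
  \<open>\<tau> < \<infinity>\<close>; so the pieces of the preimage of \<open>A\<close> reassemble to \<open>A\<close>.\<close>

lemma distr_return_map: "distr P P \<theta> = P"
proof -
  define G where "G t = {x. \<tau> ((shift ^^ t) x) = enat t}" for t
  have G_iff: "x \<in> G t \<longleftrightarrow> 0 < t \<and> W x = W ((shift ^^ t) x) \<and>
      (\<forall>s<t. 0 < s \<longrightarrow> W ((shift ^^ (t - s)) x) \<noteq> W ((shift ^^ t) x))" for x t
    by (auto simp: G_def return_time_eq_iff rewind_funpow_shift)
  have not_both: "\<not> (x \<in> G s \<and> x \<in> G t)" if "s < t" for x s t
  proof
    assume both: "x \<in> G s \<and> x \<in> G t"
    then have "0 < s" "W x = W ((shift ^^ s) x)" "W x = W ((shift ^^ t) x)" by (auto simp: G_iff)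
    moreover have "W ((shift ^^ (t - (t - s))) x) \<noteq> W ((shift ^^ t) x)"
    proof -
      have "\<forall>r<t. 0 < r \<longrightarrow> W ((shift ^^ (t - r)) x) \<noteq> W ((shift ^^ t) x)"
        using both unfolding G_iff by blast
      moreover have "t - s < t" "0 < t - s" using that \<open>0 < s\<close> by auto
      ultimately show ?thesis by blast
    qed
    moreover have "t - (t - s) = s" using that by simp
    ultimately show False by metis
  qed
  have [measurable]: "G t \<in> sets P" for t
  proof -
    have "{x \<in> space P. \<tau> ((shift ^^ t) x) = enat t} \<in> sets P" by measurable
    then show ?thesis by (simp add: G_def)
  qed
  have count: "emeasure P (\<theta> -` A) = emeasure P (A \<inter> (\<Union>t. G t))" if A [measurable]: "A \<in> sets P" for A
  proof -
    define H where "H t = {x. \<tau> x = enat t \<and> rewind t x \<in> A}" for t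
    have H_meas [measurable]: "H t \<in> sets P" for t
    proof -
      have "{x \<in> space P. \<tau> x = enat t \<and> rewind t x \<in> A} \<in> sets P" by measurable
      then show ?thesis by (simp add: H_def)
    qed
    have "emeasure P (\<theta> -` A) = emeasure P (\<Union>t. H t)"
    proof (rule emeasure_eq_AE)
      show "AE x in P. x \<in> \<theta> -` A \<longleftrightarrow> x \<in> (\<Union>t. H t)"
        using return_time_finite by eventually_elim (auto simp: H_def return_map_def)
      show "\<theta> -` A \<in> sets P"
        using measurable_sets[OF return_map_measurable A] by simp
    qed auto
    also have "\<dots> = (\<Sum>t. emeasure P (H t))"
    proof (rule suminf_emeasure[symmetric])
      show "disjoint_family H" by (auto simp: disjoint_family_on_def H_def)
    qed auto
    also have "\<dots> = (\<Sum>t. emeasure P (A \<inter> G t))"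
    proof (intro suminf_cong)
      fix t
      have "{x. (shift ^^ t) x \<in> H t} = A \<inter> G t"
        by (auto simp: H_def G_def rewind_funpow_shift)
      then show "emeasure P (H t) = emeasure P (A \<inter> G t)"
        using emeasure_funpow_shift[of "H t" t] by simp
    qed
    also have "\<dots> = emeasure P (\<Union>t. A \<inter> G t)"
    proof (rule suminf_emeasure)
      show "disjoint_family (\<lambda>t. A \<inter> G t)"
      proof (unfold disjoint_family_on_def, intro ballI impI equals0I)
        fix s t x assume "s \<noteq> t" "x \<in> A \<inter> G s \<inter> (A \<inter> G t)"
        then show False using not_both[of s t x] not_both[of t s x] by (cases "s < t") auto
      qed
    qed auto
    finally show ?thesis by simp
  qed
  have "emeasure P (\<Union>t. G t) = 1"
    using count[of UNIV] sets.top[of P] emeasure_space_1 by simp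
  then have full: "AE x in P. x \<in> (\<Union>t. G t)"
    by (simp add: emeasure_eq_measure prob_eq_1 del: UN_iff)
  show ?thesis
  proof (rule measure_eqI)
    fix A assume "A \<in> sets (distr P P \<theta>)"
    then have A [measurable]: "A \<in> sets P" by simp
    have "emeasure (distr P P \<theta>) A = emeasure P (A \<inter> (\<Union>t. G t))"
      by (subst emeasure_distr) (auto simp: count)
    also have "\<dots> = emeasure P A"
      by (rule emeasure_eq_AE) (use full in auto)
    finally show "emeasure (distr P P \<theta>) A = emeasure P A" .
  qed simp
qed

sublocale return: measure_preserving P \<theta>
  by unfold_locales (auto simp: distr_return_map)

lemma expected_return_times:
  "(\<integral>\<^sup>+x. (\<Sum>j<J. ennreal_of_enat (\<tau> ((\<theta> ^^ j) x))) \<partial>P) \<le> of_nat J * of_nat (card R)"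
proof -
  have [measurable]: "(\<lambda>x. ennreal_of_enat (\<tau> x)) \<in> borel_measurable P" by measurable
  have "(\<integral>\<^sup>+x. (\<Sum>j<J. ennreal_of_enat (\<tau> ((\<theta> ^^ j) x))) \<partial>P)
      = (\<Sum>j<J. \<integral>\<^sup>+x. ennreal_of_enat (\<tau> ((\<theta> ^^ j) x)) \<partial>P)"
    using return.funpow_measurable by (intro nn_integral_sum) measurable
  also have "\<dots> = (\<Sum>j<J. \<integral>\<^sup>+x. ennreal_of_enat (\<tau> x) \<partial>P)"
    by (intro sum.cong refl return.nn_integral_funpow) measurable
  also have "\<dots> \<le> (\<Sum>j<J. of_nat (card R))" by (intro sum_mono kac)
  finally show ?thesis by simp
qed

end

section \<open>Approximation by functions of finitely much information\<close>

text \<open>The sets with this property are closed under complements. A countable union is cut at a finite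
  stage at the cost of \<open>e / 2\<close>; the other half is shared out among the finitely many sets left.\<close>

lemma (in finite_measure) sigma_sets_approx:
  assumes G: "algebra (space M) G" "G \<subseteq> sets M"
    and A: "A \<in> sigma_sets (space M) G" and e: "e > 0"
  shows "\<exists>C\<in>G. measure M ((A - C) \<union> (C - A)) < e"
  using A e
proof (induction arbitrary: e)
  case (Basic a)
  then show ?case by (intro bexI[of _ a]) auto
next
  case Empty
  interpret algebra "space M" G by fact
  show ?case using Empty by (intro bexI[of _ "{}"]) auto
next
  case (Compl a)
  interpret algebra "space M" G by fact
  obtain C where C: "C \<in> G" "measure M ((a - C) \<union> (C - a)) < e"
    using Compl by blast
  have "a \<subseteq> space M" using Compl.hyps sigma_sets_into_sp[OF space_closed] by blast
  moreover have "C \<subseteq> space M" using C(1) space_closed by blast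
  ultimately have "(space M - a) - (space M - C) \<union> ((space M - C) - (space M - a)) = (a - C) \<union> (C - a)"
    by blast
  then show ?case using C by (intro bexI[of _ "space M - C"]) auto
next
  case (Union a)
  interpret algebra "space M" G by fact
  have a_sets [measurable]: "a i \<in> sets M" for i
    using Union.hyps[of i] sets.sigma_sets_subset[OF G(2)] by blast
  have "(\<lambda>n. measure M (\<Union>i<n. a i)) \<longlonglongrightarrow> measure M (\<Union>n. \<Union>i<n. a i)"
    by (intro finite_Lim_measure_incseq) (auto simp: incseq_def, force)
  moreover have "(\<Union>n. \<Union>i<n. a i) = (\<Union>i. a i)" by blast
  ultimately have "(\<lambda>n. measure M (\<Union>i<n. a i)) \<longlonglongrightarrow> measure M (\<Union>i. a i)" by simp
  then have "\<forall>\<^sub>F n in sequentially. measure M (\<Union>i. a i) - e / 2 < measure M (\<Union>i<n. a i)"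
    using Union.prems by (intro order_tendstoD) auto
  then obtain N where N: "measure M (\<Union>i. a i) - e / 2 < measure M (\<Union>i<N. a i)"
    unfolding eventually_sequentially by blast
  have "\<exists>C\<in>G. measure M ((a i - C) \<union> (C - a i)) < e / (2 * (N + 1))" for i
    using Union.prems by (intro Union.IH) auto
  then obtain C where C: "\<And>i. C i \<in> G" "\<And>i. measure M ((a i - C i) \<union> (C i - a i)) < e / (2 * (N + 1))"
    by metis
  have C_sets [measurable]: "C i \<in> sets M" for i using C(1) G(2) by blast
  define D where "D i = (a i - C i) \<union> (C i - a i)" for i
  have [measurable]: "D i \<in> sets M" for i unfolding D_def by measurable
  let ?C = "\<Union>i<N. C i" and ?A = "\<Union>i. a i" and ?AN = "\<Union>i<N. a i"
  have "measure M ((?A - ?C) \<union> (?C - ?A)) \<le> measure M ((?A - ?AN) \<union> (\<Union>i<N. D i))"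
    by (intro finite_measure_mono) (auto simp: D_def)
  also have "\<dots> \<le> measure M (?A - ?AN) + measure M (\<Union>i<N. D i)"
    by (intro measure_Un_le) auto
  also have "measure M (\<Union>i<N. D i) \<le> (\<Sum>i<N. measure M (D i))"
    by (intro measure_UNION_le) auto
  also have "\<dots> \<le> (\<Sum>i<N. e / (2 * (N + 1)))"
    using C(2) by (intro sum_mono less_imp_le) (simp add: D_def)
  also have "\<dots> \<le> e / 2" using Union.prems by (simp add: field_simps)
  also have "measure M (?A - ?AN) < e / 2"
    using N by (subst finite_measure_Diff) auto
  finally have "measure M ((?A - ?C) \<union> (?C - ?A)) < e" by simp
  moreover have "?C \<in> G" using C(1) by (intro finite_UN) auto
  ultimately show ?case by blast
qed

text \<open>Density plays the role of martingale convergence: the sets decided by some label form an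
  algebra, because labels refine each other, so they are dense in the sigma-algebra they generate.
  Indicators, sums and dominated limits then give all integrable functions.\<close>

lemma (in prob_space) approx_by_labels:
  fixes W :: "nat \<Rightarrow> 'a \<Rightarrow> 'b" and f :: "'a \<Rightarrow> real"
  assumes refine: "\<And>m n x y. m \<le> n \<Longrightarrow> W n x = W n y \<Longrightarrow> W m x = W m y"
    and F: "subalgebra M F"
      "sets F \<subseteq> sigma_sets (space M) {S \<in> sets M. \<exists>n. \<forall>x\<in>space M. \<forall>y\<in>space M. W n x = W n y \<longrightarrow> (x \<in> S \<longleftrightarrow> y \<in> S)}"
    and f: "f \<in> borel_measurable F" "integrable M f" and e: "e > 0"
  shows "\<exists>n h. integrable M h \<and> (\<forall>x\<in>space M. \<forall>y\<in>space M. W n x = W n y \<longrightarrow> h x = h y) \<and> (\<integral>x. \<bar>f x - h x\<bar> \<partial>M) < e"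
proof -
  define factors where "factors n h \<longleftrightarrow> (\<forall>x\<in>space M. \<forall>y\<in>space M. W n x = W n y \<longrightarrow> h x = h y)" for n and h :: "'a \<Rightarrow> real"
  have factors_mono: "factors n h" if "factors m h" "m \<le> n" for m n h
    using that refine unfolding factors_def by blast
  define G where "G = {S \<in> sets M. \<exists>n. \<forall>x\<in>space M. \<forall>y\<in>space M. W n x = W n y \<longrightarrow> (x \<in> S \<longleftrightarrow> y \<in> S)}"
  have G_alg: "algebra (space M) G"
    unfolding algebra_iff_Un
  proof (intro conjI ballI)
    show "G \<subseteq> Pow (space M)" using sets.space_closed by (auto simp: G_def)
    show "{} \<in> G" by (simp add: G_def)
    show "space M - S \<in> G" if "S \<in> G" for S using that by (auto simp: G_def)
    show "S \<union> S' \<in> G" if SS: "S \<in> G" "S' \<in> G" for S S'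
    proof -
      obtain m n where m: "\<forall>x\<in>space M. \<forall>y\<in>space M. W m x = W m y \<longrightarrow> (x \<in> S \<longleftrightarrow> y \<in> S)"
        and n: "\<forall>x\<in>space M. \<forall>y\<in>space M. W n x = W n y \<longrightarrow> (x \<in> S' \<longleftrightarrow> y \<in> S')"
        using SS unfolding G_def by blast
      have "\<forall>x\<in>space M. \<forall>y\<in>space M. W (max m n) x = W (max m n) y \<longrightarrow> (x \<in> S \<union> S' \<longleftrightarrow> y \<in> S \<union> S')"
        using m n refine[of m "max m n"] refine[of n "max m n"] by (metis Un_iff max.cobounded1 max.cobounded2)
      then show ?thesis using SS unfolding G_def by blast
    qed
  qed
  have "integrable (restr_to_subalg M F) f"
    using F f by (intro integrable_in_subalg)
  then have "\<forall>e>0. \<exists>n h. integrable M h \<and> factors n h \<and> (\<integral>x. \<bar>f x - h x\<bar> \<partial>M) < e"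
  proof (induction rule: integrable_induct)
    case (base A c)
    show ?case
    proof (intro allI impI)
      fix e :: real assume "e > 0"
      have A: "A \<in> sigma_sets (space M) G"
        using base(1) F unfolding G_def sets_restr_to_subalg[OF F(1)] by blast
      have [measurable]: "A \<in> sets M"
        using base(1) F(1) unfolding sets_restr_to_subalg[OF F(1)] subalgebra_def by blast
      obtain C where C: "C \<in> G" "measure M ((A - C) \<union> (C - A)) < e / (\<bar>c\<bar> + 1)"
      proof -
        have "G \<subseteq> sets M" unfolding G_def by blast
        moreover have "e / (\<bar>c\<bar> + 1) > 0" using \<open>e > 0\<close> by simp
        ultimately have "\<exists>C\<in>G. measure M ((A - C) \<union> (C - A)) < e / (\<bar>c\<bar> + 1)"
          by (rule sigma_sets_approx[OF G_alg _ A])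
        then show ?thesis using that by blast
      qed
      have [measurable]: "C \<in> sets M" using C unfolding G_def by blast
      obtain n where n: "\<forall>x\<in>space M. \<forall>y\<in>space M. W n x = W n y \<longrightarrow> (x \<in> C \<longleftrightarrow> y \<in> C)"
        using C unfolding G_def by blast
      let ?h = "\<lambda>x. indicator C x * c"
      have "(\<integral>x. \<bar>indicator A x *\<^sub>R c - ?h x\<bar> \<partial>M) = (\<integral>x. indicator ((A - C) \<union> (C - A)) x * \<bar>c\<bar> \<partial>M)"
        by (intro Bochner_Integration.integral_cong) (auto simp: indicator_def)
      also have "\<dots> = measure M ((A - C) \<union> (C - A)) * \<bar>c\<bar>"
        by simp
      also have "\<dots> \<le> e / (\<bar>c\<bar> + 1) * \<bar>c\<bar>"
        using C by (intro mult_right_mono) auto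
      also have "\<dots> < e" using \<open>e > 0\<close> by (simp add: field_simps)
      finally have "(\<integral>x. \<bar>indicator A x *\<^sub>R c - ?h x\<bar> \<partial>M) < e" .
      moreover have "integrable M ?h" by (simp add: emeasure_eq_measure)
      moreover have "factors n ?h"
        unfolding factors_def
      proof (intro ballI impI)
        fix x y assume "x \<in> space M" "y \<in> space M" "W n x = W n y"
        then have "x \<in> C \<longleftrightarrow> y \<in> C" using n by blast
        then show "?h x = ?h y" by (simp add: indicator_def)
      qed
      ultimately show "\<exists>n h. integrable M h \<and> factors n h \<and> (\<integral>x. \<bar>indicator A x *\<^sub>R c - h x\<bar> \<partial>M) < e"
        by blast
    qed
  next
    case (add f g)
    have fg: "integrable M f" "integrable M g"
      by (rule integrable_from_subalg[OF F(1) add.hyps(1)], rule integrable_from_subalg[OF F(1) add.hyps(2)])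
    show ?case
    proof (intro allI impI)
      fix e :: real assume "e > 0"
      then have "e / 2 > 0" by simp
      then obtain m h n h' where h: "integrable M h" "factors m h" "(\<integral>x. \<bar>f x - h x\<bar> \<partial>M) < e / 2"
        and h': "integrable M h'" "factors n h'" "(\<integral>x. \<bar>g x - h' x\<bar> \<partial>M) < e / 2"
        using add.IH(1)[rule_format, OF \<open>e / 2 > 0\<close>] add.IH(2)[rule_format, OF \<open>e / 2 > 0\<close>] by (elim exE conjE) (rule that)
      let ?h = "\<lambda>x. h x + h' x"
      have "factors (max m n) ?h"
        unfolding factors_def
      proof (intro ballI impI)
        fix x y assume "x \<in> space M" "y \<in> space M" "W (max m n) x = W (max m n) y"
        then have "h x = h y" "h' x = h' y"
          using factors_mono[OF h(2), of "max m n"] factors_mono[OF h'(2), of "max m n"]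
          unfolding factors_def by (meson max.cobounded1 max.cobounded2)+
        then show "?h x = ?h y" by simp
      qed
      moreover have "(\<integral>x. \<bar>(f x + g x) - ?h x\<bar> \<partial>M) \<le> (\<integral>x. \<bar>f x - h x\<bar> + \<bar>g x - h' x\<bar> \<partial>M)"
        using fg h h' by (intro integral_mono) auto
      moreover have "\<dots> = (\<integral>x. \<bar>f x - h x\<bar> \<partial>M) + (\<integral>x. \<bar>g x - h' x\<bar> \<partial>M)"
        using fg h h' by simp
      moreover have "integrable M ?h" using h h' by simp
      ultimately show "\<exists>n h. integrable M h \<and> factors n h \<and> (\<integral>x. \<bar>(f x + g x) - h x\<bar> \<partial>M) < e"
        using h(3) h'(3) by (intro exI[of _ "max m n"] exI[of _ ?h]) simp
    qed
  next
    case (lim f s)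
    have fs: "integrable M f" "\<And>i. integrable M (s i)"
      by (rule integrable_from_subalg[OF F(1) lim.hyps(4)], rule integrable_from_subalg[OF F(1) lim.hyps(1)])
    show ?case
    proof (intro allI impI)
      fix e :: real assume "e > 0"
      have "(\<lambda>i. \<integral>x. \<bar>f x - s i x\<bar> \<partial>M) \<longlonglongrightarrow> (\<integral>x. 0 \<partial>M)"
      proof (rule integral_dominated_convergence[where w = "\<lambda>x. 3 * \<bar>f x\<bar>"])
        show "AE x in M. (\<lambda>i. \<bar>f x - s i x\<bar>) \<longlonglongrightarrow> 0"
        proof (rule AE_I2)
          fix x assume "x \<in> space M"
          then have "(\<lambda>i. s i x) \<longlonglongrightarrow> f x" using lim.hyps(2) by (simp add: space_restr_to_subalg)
          then have "(\<lambda>i. \<bar>f x - s i x\<bar>) \<longlonglongrightarrow> \<bar>f x - f x\<bar>" by (intro tendsto_intros)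
          then show "(\<lambda>i. \<bar>f x - s i x\<bar>) \<longlonglongrightarrow> 0" by simp
        qed
        show "AE x in M. norm \<bar>f x - s i x\<bar> \<le> 3 * \<bar>f x\<bar>" for i
        proof (rule AE_I2)
          fix x assume "x \<in> space M"
          then have "\<bar>s i x\<bar> \<le> 2 * \<bar>f x\<bar>" using lim.hyps(3)[of x i] by (simp add: space_restr_to_subalg)
          then show "norm \<bar>f x - s i x\<bar> \<le> 3 * \<bar>f x\<bar>" unfolding real_norm_def by linarith
        qed
      qed (use fs in auto)
      then have "\<forall>\<^sub>F i in sequentially. (\<integral>x. \<bar>f x - s i x\<bar> \<partial>M) < e / 2"
        using \<open>e > 0\<close> by (intro order_tendstoD(2)) auto
      then obtain i where i: "(\<integral>x. \<bar>f x - s i x\<bar> \<partial>M) < e / 2"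
        unfolding eventually_sequentially by blast
      have "e / 2 > 0" using \<open>e > 0\<close> by simp
      obtain n h where h: "integrable M h" "factors n h" "(\<integral>x. \<bar>s i x - h x\<bar> \<partial>M) < e / 2"
        using lim.IH[of i, rule_format, OF \<open>e / 2 > 0\<close>] by (elim exE conjE) (rule that)
      have "(\<integral>x. \<bar>f x - h x\<bar> \<partial>M) \<le> (\<integral>x. \<bar>f x - s i x\<bar> + \<bar>s i x - h x\<bar> \<partial>M)"
        using fs h by (intro integral_mono) auto
      also have "\<dots> = (\<integral>x. \<bar>f x - s i x\<bar> \<partial>M) + (\<integral>x. \<bar>s i x - h x\<bar> \<partial>M)"
        using fs h by simp
      also have "\<dots> < e" using i h by simp
      finally show "\<exists>n h. integrable M h \<and> factors n h \<and> (\<integral>x. \<bar>f x - h x\<bar> \<partial>M) < e"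
        using h by blast
    qed
  qed
  then show ?thesis using e unfolding factors_def by blast
qed

section \<open>The sample mean along return times\<close>

definition sample_mean :: "((int \<Rightarrow> real) \<Rightarrow> 'b) \<Rightarrow> nat \<Rightarrow> (int \<Rightarrow> real) \<Rightarrow> real" where
  "sample_mean W J x = (\<Sum>j<J. (return_map W ^^ Suc j) x 0) / real J"

locale bounded_paths = stationary_paths P for P +
  fixes K :: real
  assumes K_pos: "0 < K" and bounded: "AE x in P. \<forall>i. \<bar>x i\<bar> \<le> K"
begin

abbreviation "m \<equiv> past_mean P (\<lambda>t x. x t)"

sublocale past: sigma_finite_subalgebra P "past_of P"
  by (rule finite_measure_subalgebra_is_sigma_finite) (unfold_locales, rule subalgebra_past)

lemma coord_bounded: "AE x in P. \<bar>x i\<bar> \<le> K"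
  using bounded by eventually_elim blast

lemma coord_integrable: "integrable P (\<lambda>x. x i)"
  using coord_bounded by (intro integrable_const_bound[of _ K]) auto

lemma mean_past: "m \<in> borel_measurable (past_of P)"
  unfolding past_mean_def by (rule borel_measurable_cond_exp)

lemma mean_measurable [measurable]: "m \<in> borel_measurable P"
  by (rule measurable_from_subalg[OF subalgebra_past mean_past])

lemma mean_bounded: "AE x in P. \<bar>m x\<bar> \<le> K"
proof -
  have "AE x in P. x 0 \<le> K" "AE x in P. - K \<le> x 0"
    using coord_bounded[of 0] by (eventually_elim, simp)+
  then have "AE x in P. m x \<le> K" "AE x in P. - K \<le> m x"
    unfolding past_mean_def
    using past.real_cond_exp_le_c[OF coord_integrable] past.real_cond_exp_ge_c[OF coord_integrable]
    by auto
  then show ?thesis by eventually_elim (simp add: abs_le_iff)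
qed

lemma mean_integrable: "integrable P m"
  using mean_bounded by (intro integrable_const_bound[of _ K]) auto

definition innovation :: "(int \<Rightarrow> real) \<Rightarrow> real" where
  "innovation x = x 0 - m x"

lemma innovation_measurable [measurable]: "innovation \<in> borel_measurable P"
  unfolding innovation_def by measurable

lemma innovation_bounded: "AE x in P. \<bar>innovation x\<bar> \<le> 2 * K"
  using coord_bounded[of 0] mean_bounded by eventually_elim (simp add: innovation_def)

lemma innovation_orthogonal:
  assumes u: "u \<in> borel_measurable (past_of P)" and C: "AE x in P. \<bar>u x\<bar> \<le> C"
  shows "(\<integral>x. u x * innovation x \<partial>P) = 0"
proof -
  have [measurable]: "u \<in> borel_measurable P"
    by (rule measurable_from_subalg[OF subalgebra_past u])
  have "AE x in P. norm (u x * x 0) \<le> C * K" "AE x in P. norm (u x * m x) \<le> C * K"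
    using C coord_bounded[of 0] mean_bounded
    by (eventually_elim, auto simp: abs_mult intro!: mult_mono order_trans[OF abs_ge_zero])+
  then have int: "integrable P (\<lambda>x. u x * x 0)" "integrable P (\<lambda>x. u x * m x)"
    by (auto intro!: integrable_const_bound[of _ "C * K"])
  have "(\<integral>x. u x * m x \<partial>P) = (\<integral>x. u x * x 0 \<partial>P)"
    unfolding past_mean_def
    by (rule past.real_cond_exp_intg(2)[OF int(1) u]) simp
  then show ?thesis using int by (simp add: innovation_def algebra_simps)
qed

end

locale bounded_labelled_paths = labelled_paths P W R + bounded_paths P K for P W R K
begin

definition innov_sum :: "nat \<Rightarrow> (int \<Rightarrow> real) \<Rightarrow> real" where
  "innov_sum J x = (\<Sum>j<J. innovation ((\<theta> ^^ Suc j) x))"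

lemma innov_sum_Suc: "innov_sum (Suc J) x = innovation (\<theta> x) + innov_sum J (\<theta> x)"
  unfolding innov_sum_def by (subst sum.lessThan_Suc_shift) (simp add: funpow_swap1)

lemma innov_sum_measurable [measurable]: "innov_sum J \<in> borel_measurable P"
  unfolding innov_sum_def using return.funpow_measurable by measurable

lemma innov_sum_bounded: "AE x in P. \<bar>innov_sum J x\<bar> \<le> real J * (2 * K)"
proof -
  have "AE x in P. \<forall>j. \<bar>innovation ((\<theta> ^^ Suc j) x)\<bar> \<le> 2 * K"
    unfolding AE_all_countable by (intro allI return.AE_funpow innovation_bounded)
  then show ?thesis
  proof eventually_elim
    case (elim x)
    have "\<bar>innov_sum J x\<bar> \<le> (\<Sum>j<J. 2 * K)"
      unfolding innov_sum_def using elim by (intro order_trans[OF sum_abs] sum_mono) blast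
    then show ?case by simp
  qed
qed

lemma funpow_return_map_past: "(\<theta> ^^ j) \<in> past_of P \<rightarrow>\<^sub>M past_of P"
  by (induction j) (auto simp: id_def comp_def intro: measurable_compose[OF _ return_map_past])

text \<open>This is \<open>\<theta> x 0\<close> up to the null event of no return. Unlike \<open>\<theta> x 0\<close>, it involves the past
  of \<open>x\<close> only, also on that event.\<close>

definition previous :: "(int \<Rightarrow> real) \<Rightarrow> real" where
  "previous x = (case \<tau> x of enat t \<Rightarrow> x (- int t) | \<infinity> \<Rightarrow> 0)"

lemma previous_past: "previous \<in> borel_measurable (past_of P)"
proof -
  define c :: "enat \<Rightarrow> (int \<Rightarrow> real) \<Rightarrow> real"
    where "c n x = (case n of enat t \<Rightarrow> if t = 0 then 0 else x (- int t) | \<infinity> \<Rightarrow> 0)" for n x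
  have "c n \<in> borel_measurable (past_of P)" for n
  proof (cases n)
    case (enat t)
    then show ?thesis
      by (cases "t = 0") (simp_all add: c_def[abs_def] coord_past_measurable)
  qed (simp add: c_def[abs_def])
  then have "(\<lambda>x. c (\<tau> x) x) \<in> borel_measurable (past_of P)"
    by (rule measurable_compose_countable[OF _ return_time_past])
  moreover have "previous = (\<lambda>x. c (\<tau> x) x)"
  proof
    show "previous x = c (\<tau> x) x" for x
    unfolding previous_def c_def using return_time_eq_iff[of W x 0] by (cases "\<tau> x") (auto simp: zero_enat_def)
  qed
  ultimately show ?thesis by simp
qed

text \<open>The innovations at return times are made at negative times that the past determines. The sum
  agrees with a function of the past only almost surely, as \<open>\<theta>\<close> is the identity where there is
  no return.\<close>

lemma innov_sum_past:
  obtains u where "u \<in> borel_measurable (past_of P)" "AE x in P. u x = innov_sum J x"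
proof
  let ?u = "\<lambda>x. \<Sum>j<J. previous ((\<theta> ^^ j) x) - m ((\<theta> ^^ Suc j) x)"
  show "?u \<in> borel_measurable (past_of P)"
    by (intro borel_measurable_sum borel_measurable_diff measurable_compose[OF funpow_return_map_past]
      previous_past mean_past)
  have "AE x in P. \<forall>j. \<tau> ((\<theta> ^^ j) x) \<noteq> \<infinity>"
    unfolding AE_all_countable by (intro allI return.AE_funpow return_time_finite)
  then show "AE x in P. ?u x = innov_sum J x"
  proof eventually_elim
    case (elim x)
    have "previous y = \<theta> y 0" if "\<tau> y \<noteq> \<infinity>" for y
      using that by (auto simp: previous_def return_map_coord)
    then show ?case using elim by (simp add: innov_sum_def innovation_def)
  qed
qed

text \<open>As \<open>innov_sum (Suc J) = (innovation + innov_sum J) \<circ> \<theta>\<close> and \<open>\<theta>\<close> preserves the law, the second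
  moment grows in each step by that of one innovation; the mixed term vanishes since
  \<open>innov_sum J\<close> is almost surely a function of the past.\<close>

lemma innov_sum_square: "(\<integral>x. (innov_sum J x)\<^sup>2 \<partial>P) \<le> real J * (2 * K)\<^sup>2"
proof (induction J)
  case 0
  then show ?case by (simp add: innov_sum_def)
next
  case (Suc J)
  obtain u where u: "u \<in> borel_measurable (past_of P)" "AE x in P. u x = innov_sum J x"
    by (rule innov_sum_past)
  have [measurable]: "u \<in> borel_measurable P"
    by (rule measurable_from_subalg[OF subalgebra_past u(1)])
  have "AE x in P. \<bar>u x\<bar> \<le> real J * (2 * K)"
    using u(2) innov_sum_bounded[of J] by eventually_elim simp
  then have "(\<integral>x. u x * innovation x \<partial>P) = 0"
    by (rule innovation_orthogonal[OF u(1)])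
  moreover have "(\<integral>x. u x * innovation x \<partial>P) = (\<integral>x. innov_sum J x * innovation x \<partial>P)"
    using u(2) by (intro integral_cong_AE) auto
  ultimately have orth: "(\<integral>x. innov_sum J x * innovation x \<partial>P) = 0" by simp
  have sq: "AE x in P. (innovation x)\<^sup>2 \<le> (2 * K)\<^sup>2"
    using innovation_bounded by eventually_elim (metis abs_ge_zero power2_abs power_mono)
  have int: "integrable P (\<lambda>x. (innovation x)\<^sup>2)"
    using sq by (intro integrable_const_bound[of _ "(2 * K)\<^sup>2"]) auto
  have "AE x in P. norm ((innov_sum J x)\<^sup>2) \<le> (real J * (2 * K))\<^sup>2"
    using innov_sum_bounded[of J] by eventually_elim (metis abs_ge_zero power2_abs power_mono real_norm_def abs_power2)
  then have int': "integrable P (\<lambda>x. (innov_sum J x)\<^sup>2)"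
    by (intro integrable_const_bound) auto
  have "AE x in P. norm (innov_sum J x * innovation x) \<le> (real J * (2 * K)) * (2 * K)"
    using innov_sum_bounded[of J] innovation_bounded
  proof eventually_elim
    case (elim x)
    show ?case unfolding real_norm_def abs_mult using elim K_pos by (intro mult_mono) auto
  qed
  then have int'': "integrable P (\<lambda>x. innov_sum J x * innovation x)"
    by (intro integrable_const_bound) auto
  have "(\<integral>x. (innov_sum (Suc J) x)\<^sup>2 \<partial>P) = (\<integral>x. (innovation x + innov_sum J x)\<^sup>2 \<partial>P)"
    unfolding innov_sum_Suc
    using return.integral_funpow[of "\<lambda>x. (innovation x + innov_sum J x)\<^sup>2" 1] by simp
  also have "\<dots> = (\<integral>x. (innovation x)\<^sup>2 + (2 * (innov_sum J x * innovation x) + (innov_sum J x)\<^sup>2) \<partial>P)"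
    by (intro Bochner_Integration.integral_cong) (auto simp: power2_eq_square algebra_simps)
  also have "\<dots> = (\<integral>x. (innovation x)\<^sup>2 \<partial>P) + (\<integral>x. (innov_sum J x)\<^sup>2 \<partial>P)"
    using int int' int'' orth by simp
  also have "(\<integral>x. (innovation x)\<^sup>2 \<partial>P) \<le> (2 * K)\<^sup>2"
    using sq int by (intro integral_le_const) auto
  finally show ?case using Suc by (simp add: algebra_simps)
qed

lemma innov_sum_L1:
  assumes "J \<ge> 1"
  shows "(\<integral>x. \<bar>innov_sum J x / real J\<bar> \<partial>P) \<le> 2 * K / sqrt (real J)"
proof -
  define c where "c = 2 * K / sqrt (real J)"
  have c: "c > 0" "real J * (2 * K)\<^sup>2 = c\<^sup>2 * (real J)\<^sup>2"
    using assms K_pos by (auto simp: c_def power_divide field_simps power2_eq_square)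
  have bd: "AE x in P. \<bar>innov_sum J x\<bar> \<le> real J * (2 * K)" by (rule innov_sum_bounded)
  then have int: "integrable P (innov_sum J)" by (intro integrable_const_bound) auto
  have "AE x in P. norm ((innov_sum J x)\<^sup>2) \<le> (real J * (2 * K))\<^sup>2"
    using bd by eventually_elim (metis abs_ge_zero power2_abs power_mono real_norm_def abs_power2)
  then have int2: "integrable P (\<lambda>x. (innov_sum J x)\<^sup>2)"
    by (intro integrable_const_bound) auto
  have amgm: "\<bar>y\<bar> \<le> (c + y\<^sup>2 / c) / 2" for y :: real
  proof -
    have "0 \<le> (\<bar>y\<bar> - c)\<^sup>2" by simp
    then have "2 * c * \<bar>y\<bar> \<le> c\<^sup>2 + y\<^sup>2" by (simp add: power2_diff algebra_simps)
    then show ?thesis using c(1) by (simp add: field_simps power2_eq_square)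
  qed
  \<comment> \<open>the constant \<open>c\<close> is the bound on the norm in \<open>L\<^sup>2\<close>, where this inequality loses nothing\<close>
  have "(\<integral>x. \<bar>innov_sum J x / real J\<bar> \<partial>P) \<le> (\<integral>x. (c + (innov_sum J x / real J)\<^sup>2 / c) / 2 \<partial>P)"
  proof (rule integral_mono)
    show "\<bar>innov_sum J x / real J\<bar> \<le> (c + (innov_sum J x / real J)\<^sup>2 / c) / 2" for x
      by (rule amgm)
  qed (use int int2 in \<open>auto simp: power_divide\<close>)
  also have "\<dots> = (c + (\<integral>x. (innov_sum J x)\<^sup>2 \<partial>P) / (real J)\<^sup>2 / c) / 2"
    using int2 prob_space by (simp add: power_divide)
  also have "\<dots> \<le> (c + (c\<^sup>2 * (real J)\<^sup>2) / (real J)\<^sup>2 / c) / 2"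
    using innov_sum_square[of J] c by (intro divide_right_mono add_left_mono) auto
  also have "\<dots> = c" using c(1) assms by (simp add: power2_eq_square)
  finally show ?thesis unfolding c_def .
qed

lemma sample_mean_measurable [measurable]: "sample_mean W J \<in> borel_measurable P"
proof -
  have [measurable]: "(\<lambda>x. (\<theta> ^^ Suc j) x 0) \<in> borel_measurable P" for j
    by (rule measurable_compose[OF return.funpow_measurable coord_measurable])
  show ?thesis unfolding sample_mean_def by measurable
qed

lemma sample_mean_bounded: "AE x in P. \<bar>sample_mean W J x\<bar> \<le> K"
proof -
  have "AE x in P. \<forall>j. \<bar>(\<theta> ^^ Suc j) x 0\<bar> \<le> K"
    unfolding AE_all_countable by (intro allI return.AE_funpow coord_bounded)
  then show ?thesis
  proof eventually_elim
    case (elim x)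
    have "\<bar>\<Sum>j<J. (\<theta> ^^ Suc j) x 0\<bar> \<le> (\<Sum>j<J. K)"
      using elim by (intro order_trans[OF sum_abs] sum_mono) blast
    then show ?case using K_pos
      by (cases "J = 0") (auto simp: sample_mean_def field_simps)
  qed
qed

lemma sample_mean_integrable: "integrable P (sample_mean W J)"
  using sample_mean_bounded by (intro integrable_const_bound[of _ K]) auto

text \<open>With \<open>x 0 = innovation x + (m x - h x) + h x\<close>, the innovations average out at rate
  \<open>1 / sqrt J\<close>, the middle terms contribute at most the norm of \<open>m - h\<close> because \<open>\<theta>\<close> preserves
  the law, and \<open>h\<close> does not change along the return times; comparing it with \<open>m\<close> at the end
  costs the same norm once more.\<close>

lemma sample_mean_close:
  assumes J: "J \<ge> 1" and h: "integrable P h" and W_h: "\<And>x y. W x = W y \<Longrightarrow> h x = h y"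
  shows "(\<integral>x. \<bar>sample_mean W J x - m x\<bar> \<partial>P) \<le> 2 * K / sqrt (real J) + 2 * (\<integral>x. \<bar>m x - h x\<bar> \<partial>P)"
proof -
  let ?r = "\<lambda>x. \<bar>m x - h x\<bar>"
  have [measurable]: "h \<in> borel_measurable P" using h by auto
  have r: "integrable P ?r" using mean_integrable h by auto
  have rj: "integrable P (\<lambda>x. ?r ((\<theta> ^^ Suc j) x))" for j
    by (rule return.integrable_funpow[OF r])
  have h_inv: "h ((\<theta> ^^ j) x) = h x" for j x by (rule W_h) simp
  have I: "integrable P (\<lambda>x. \<bar>innov_sum J x / real J\<bar>)"
    using innov_sum_bounded[of J] by (intro integrable_abs integrable_divide integrable_const_bound) auto
  have split: "\<bar>sample_mean W J x - m x\<bar>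
      \<le> \<bar>innov_sum J x / real J\<bar> + (\<Sum>j<J. ?r ((\<theta> ^^ Suc j) x)) / real J + ?r x" for x
  proof -
    have "(\<Sum>j<J. (\<theta> ^^ Suc j) x 0) = innov_sum J x + (\<Sum>j<J. m ((\<theta> ^^ Suc j) x) - h ((\<theta> ^^ Suc j) x)) + real J * h x"
      unfolding innov_sum_def innovation_def h_inv by (simp add: sum_subtractf)
    then have "sample_mean W J x - m x = innov_sum J x / real J
        + (\<Sum>j<J. m ((\<theta> ^^ Suc j) x) - h ((\<theta> ^^ Suc j) x)) / real J + (h x - m x)"
      unfolding sample_mean_def using J by (simp add: add_divide_distrib)
    moreover have "\<bar>(\<Sum>j<J. m ((\<theta> ^^ Suc j) x) - h ((\<theta> ^^ Suc j) x)) / real J\<bar>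
        \<le> (\<Sum>j<J. ?r ((\<theta> ^^ Suc j) x)) / real J"
      unfolding abs_divide by (auto intro!: divide_right_mono sum_abs)
    ultimately show ?thesis by linarith
  qed
  have "(\<integral>x. \<bar>sample_mean W J x - m x\<bar> \<partial>P)
      \<le> (\<integral>x. \<bar>innov_sum J x / real J\<bar> + (\<Sum>j<J. ?r ((\<theta> ^^ Suc j) x)) / real J + ?r x \<partial>P)"
  proof (rule integral_mono)
    show "integrable P (\<lambda>x. \<bar>sample_mean W J x - m x\<bar>)"
      by (intro integrable_abs Bochner_Integration.integrable_diff sample_mean_integrable mean_integrable)
  qed (use I r rj split in auto)
  also have "\<dots> = (\<integral>x. \<bar>innov_sum J x / real J\<bar> \<partial>P)
      + (\<Sum>j<J. \<integral>x. ?r ((\<theta> ^^ Suc j) x) \<partial>P) / real J + (\<integral>x. ?r x \<partial>P)"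
    using I r rj by (simp del: funpow.simps abs_divide)
  also have "(\<Sum>j<J. \<integral>x. ?r ((\<theta> ^^ Suc j) x) \<partial>P) = real J * (\<integral>x. ?r x \<partial>P)"
    by (simp add: return.integral_funpow[where f = ?r] del: funpow.simps)
  finally show ?thesis using innov_sum_L1[OF J] J by simp
qed

end

section \<open>The estimate as a sample mean\<close>

lemma recurrence_label_iff:
  "(\<forall>i\<in>{1..l}. cell B (x (- int i - int t)) = cell B (x (- int i))) \<longleftrightarrow>
     word B l (rewind t x) = word B l x"
  by (simp add: word_eq_iff rewind_def)

lemma recurrence_time_step:
  assumes y: "y = rewind t x" "word B l y = word B l x"
  shows "Inf {enat u |u. enat t < enat u \<and> word B l (rewind u x) = word B l x}
    = enat t + return_time (word B l) y"
proof (cases "return_time (word B l) y")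
  case (enat s)
  have s: "0 < s" "word B l (rewind s y) = word B l y"
    "\<And>r. r < s \<Longrightarrow> 0 < r \<Longrightarrow> word B l (rewind r y) \<noteq> word B l y"
    using enat unfolding return_time_eq_iff by auto
  have "Inf {enat u |u. enat t < enat u \<and> word B l (rewind u x) = word B l x} = enat (t + s)"
    unfolding enat_Inf_eq_iff
  proof (intro conjI allI impI)
    show "enat t < enat (t + s)" using s(1) by simp
    show "word B l (rewind (t + s) x) = word B l x"
      using s(2) y by (simp add: rewind_rewind add.commute)
    fix u assume u: "u < t + s"
    show "\<not> (enat t < enat u \<and> word B l (rewind u x) = word B l x)"
    proof
      assume *: "enat t < enat u \<and> word B l (rewind u x) = word B l x"
      then have "rewind u x = rewind (u - t) y" using y(1) by (simp add: rewind_rewind)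
      moreover have "u - t < s" "0 < u - t" using * u by auto
      ultimately show False using * s(3)[of "u - t"] y(2) by simp
    qed
  qed
  then show ?thesis by (simp add: enat)
next
  case infinity
  have "\<not> (enat t < enat u \<and> word B l (rewind u x) = word B l x)" for u
  proof
    assume *: "enat t < enat u \<and> word B l (rewind u x) = word B l x"
    then have "rewind u x = rewind (u - t) y" using y(1) by (simp add: rewind_rewind)
    moreover have "word B l (rewind (u - t) y) \<noteq> word B l y"
      using less_return_time_iff[of "u - t" "word B l" y] * infinity by auto
    ultimately show False using * y(2) by simp
  qed
  then show ?thesis using infinity by (simp add: Inf_enat_def)
qed

text \<open>The next recurrence of the word is the first return of the path moved back to the previous
  recurrence, because both paths show the same word.\<close>

lemma recurrence_time_Suc_return:
  fixes B l defines "W \<equiv> word B l"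
  shows recurrence_time_Suc_eq: "recurrence_time B l x (Suc j) = recurrence_time B l x j + return_time W ((return_map W ^^ j) x)"
    and funpow_return_map_eq: "recurrence_time B l x j = enat t \<Longrightarrow> (return_map W ^^ j) x = rewind t x"
proof -
  have step: "recurrence_time B l x (Suc j) = recurrence_time B l x j + return_time W ((return_map W ^^ j) x)"
    if "\<And>t. recurrence_time B l x j = enat t \<Longrightarrow> (return_map W ^^ j) x = rewind t x" for j
  proof (cases "recurrence_time B l x j")
    case (enat t)
    have "word B l ((return_map W ^^ j) x) = word B l x" unfolding W_def by simp
    from recurrence_time_step[OF that[OF enat] this] show ?thesis
      unfolding recurrence_time.simps recurrence_label_iff enat W_def .
  next
    case infinity
    then show ?thesis by (simp add: Inf_enat_def)
  qed
  have path: "recurrence_time B l x j = enat t \<Longrightarrow> (return_map W ^^ j) x = rewind t x" for j t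
  proof (induction j arbitrary: t)
    case 0
    then show ?case by (simp add: zero_enat_def)
  next
    case (Suc j)
    have "recurrence_time B l x j + return_time W ((return_map W ^^ j) x) = enat t"
      using step[OF Suc.IH] Suc.prems by simp
    then obtain a b where ab: "recurrence_time B l x j = enat a" "return_time W ((return_map W ^^ j) x) = enat b" "a + b = t"
      by (cases "recurrence_time B l x j"; cases "return_time W ((return_map W ^^ j) x)") auto
    show ?case
      using ab Suc.IH[OF ab(1)] by (simp add: return_map_def rewind_rewind add.commute)
  qed
  show "recurrence_time B l x (Suc j) = recurrence_time B l x j + return_time W ((return_map W ^^ j) x)"
    by (rule step[OF path])
  show "recurrence_time B l x j = enat t \<Longrightarrow> (return_map W ^^ j) x = rewind t x"
    by (rule path)
qed

lemma recurrence_time_eq_sum: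
  "recurrence_time B l x J = (\<Sum>j<J. return_time (word B l) ((return_map (word B l) ^^ j) x))"
  by (induction J) (simp_all only: recurrence_time_Suc_eq, simp_all)

lemma mean_empirical_estimate:
  assumes "J \<ge> 1" and fin: "recurrence_time B l x J \<noteq> \<infinity>"
  shows "(\<integral>y. y \<partial>empirical_estimate B l J x) = sample_mean (word B l) J x"
proof -
  have coord: "x (- int (the_enat (recurrence_time B l x j))) = (return_map (word B l) ^^ j) x 0"
    if "j \<le> J" for j
  proof -
    obtain N where "recurrence_time B l x J = enat N" using fin by auto
    then obtain t where "recurrence_time B l x j = enat t"
      using recurrence_time_mono[OF \<open>j \<le> J\<close>, of B l x] by (metis enat_ile)
    then show ?thesis using funpow_return_map_eq[of B l x j t] by (simp add: rewind_def)
  qed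
  have "(\<integral>y. y \<partial>empirical_estimate B l J x) =
      (\<integral>j. x (- int (the_enat (recurrence_time B l x j))) \<partial>uniform_count_measure {1..J})"
    unfolding empirical_estimate_def by (subst integral_distr) auto
  also have "\<dots> = (\<Sum>j\<in>{1..J}. x (- int (the_enat (recurrence_time B l x j)))) / real J"
    by (subst integral_uniform_count_measure) auto
  also have "(\<Sum>j\<in>{1..J}. x (- int (the_enat (recurrence_time B l x j)))) = (\<Sum>j\<in>{1..J}. (return_map (word B l) ^^ j) x 0)"
    by (intro sum.cong refl coord) auto
  also have "\<dots> = (\<Sum>j<J. (return_map (word B l) ^^ Suc j) x 0)"
    by (rule sum.reindex_bij_witness[of _ Suc "\<lambda>j. j - 1"]) auto
  finally show ?thesis by (simp only: sample_mean_def)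
qed

section \<open>Consistency of the backward estimate\<close>

lemma cesaro_zero:
  fixes a :: "nat \<Rightarrow> real"
  assumes "a \<longlonglongrightarrow> 0" and nonneg: "\<And>t. 0 \<le> a t"
  shows "(\<lambda>n. (\<Sum>t<n. a t) / real n) \<longlonglongrightarrow> 0"
proof (rule LIMSEQ_I)
  fix e :: real assume "e > 0"
  then have "\<forall>\<^sub>F t in sequentially. a t < e / 2"
    using assms by (intro order_tendstoD(2)) auto
  then obtain N where N: "\<And>t. t \<ge> N \<Longrightarrow> a t < e / 2"
    unfolding eventually_sequentially by blast
  have "\<forall>\<^sub>F n in sequentially. (\<Sum>t<N. a t) / real n < e / 2"
    using \<open>e > 0\<close> by (intro order_tendstoD(2)[OF lim_const_over_n]) auto
  then have "\<forall>\<^sub>F n in sequentially. norm ((\<Sum>t<n. a t) / real n - 0) < e"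
    using eventually_gt_at_top[of 0]
  proof eventually_elim
    case (elim n)
    have "(\<Sum>t<n. a t) \<le> (\<Sum>t\<in>{..<N} \<union> {..<n}. if t < N then a t else e / 2)"
    proof -
      have "(\<Sum>t<n. a t) \<le> (\<Sum>t<n. if t < N then a t else e / 2)"
        using N by (intro sum_mono) (auto intro: less_imp_le)
      also have "\<dots> \<le> (\<Sum>t\<in>{..<N} \<union> {..<n}. if t < N then a t else e / 2)"
        using nonneg \<open>e > 0\<close> by (intro sum_mono2) auto
      finally show ?thesis .
    qed
    also have "\<dots> = (\<Sum>t<N. a t) + (\<Sum>t\<in>{N..<n}. e / 2)"
    proof -
      have "{..<N} \<union> {..<n} = {..<N} \<union> {N..<n}" by auto
      then show ?thesis by (simp add: sum.union_disjoint ivl_disj_int)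
    qed
    also have "\<dots> < e * real n"
    proof -
      have "real (n - N) * (e / 2) \<le> real n * (e / 2)"
        using \<open>e > 0\<close> by (intro mult_right_mono) auto
      moreover have "(\<Sum>t<N. a t) < e / 2 * real n" using elim by (simp add: field_simps)
      ultimately show ?thesis by (simp add: algebra_simps)
    qed
    finally show ?case using elim(2) sum_nonneg[of "{..<n}" a] nonneg
      by (simp add: field_simps)
  qed
  then show "\<exists>n0. \<forall>n\<ge>n0. norm ((\<Sum>t<n. a t) / real n - 0) < e"
    unfolding eventually_sequentially .
qed

locale forecast = bounded_paths P K for P K +
  fixes B :: "nat \<Rightarrow> real set set" and l J k :: "nat \<Rightarrow> nat" and \<epsilon> :: "nat \<Rightarrow> real"
    and Q :: "real measure"
  assumes field: "\<And>i. i \<ge> 1 \<Longrightarrow> algebra UNIV (B i)"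
    and finite_field: "\<And>i. i \<ge> 1 \<Longrightarrow> finite (B i)"
    and field_mono: "\<And>i j. 1 \<le> i \<Longrightarrow> i \<le> j \<Longrightarrow> B i \<subseteq> B j"
    and field_gen: "sigma_sets UNIV (\<Union>i\<in>{1..}. B i) = sets borel"
    and l_mono: "\<And>i j. 1 \<le> i \<Longrightarrow> i \<le> j \<Longrightarrow> l i \<le> l j"
    and l_unbounded: "\<And>N. \<exists>i\<ge>1. N \<le> l i"
    and J_pos: "\<And>i. i \<ge> 1 \<Longrightarrow> J i \<ge> 1"
    and k_pos: "\<And>n. k n \<ge> 1"
    and k_lim: "filterlim k at_top sequentially"
    and J_lim: "filterlim (\<lambda>n. J (k n)) at_top sequentially"
    and \<epsilon>_pos: "\<And>i. i \<ge> 1 \<Longrightarrow> \<epsilon> i > 0" and \<epsilon>_lim: "\<epsilon> \<longlonglongrightarrow> 0"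
    and growth: "\<forall>\<^sub>F n in sequentially.
           real n \<ge> real (l (k n)) + real (J (k n)) * real (card (atoms (B (k n)))) ^ l (k n) / \<epsilon> (k n)"
    and Q: "prob_space Q" "sets Q = sets borel" "measure Q {-K..K} = 1"
begin

lemma field_borel: "i \<ge> 1 \<Longrightarrow> B i \<subseteq> sets borel"
  unfolding field_gen[symmetric] by (blast intro: sigma_sets.Basic)

lemma bounded_labelled_paths_word:
  assumes "i \<ge> 1"
  shows "bounded_labelled_paths P (word (B i) n) (words (B i) n) K"
proof
  show "finite (words (B i) n)"
    using finite_field[OF assms] by (intro finite_PiE) (auto intro: finite_atoms)
  show "word (B i) n \<in> past_of P \<rightarrow>\<^sub>M count_space (words (B i) n)"
    by (rule measurable_word[OF field finite_field field_borel])
       (use assms in \<open>auto intro: coord_past_measurable\<close>)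
qed

abbreviation "W i \<equiv> word (B i) (l i)"

abbreviation "est \<equiv> backward_mean B l J k Q (\<lambda>t x. x t)"

abbreviation "fits n \<equiv> {x. sample_length (B (k n)) (l (k n)) (J (k n)) x \<le> enat n}"

lemma est_eq:
  "est n x = (if x \<in> fits n then sample_mean (W (k n)) (J (k n)) x else (\<integral>y. y \<partial>Q))"
proof (cases "x \<in> fits n")
  case True
  then have "recurrence_time (B (k n)) (l (k n)) x (J (k n)) \<noteq> \<infinity>"
    by (cases "recurrence_time (B (k n)) (l (k n)) x (J (k n))") (auto simp: sample_length_def)
  then show ?thesis
    using True mean_empirical_estimate[OF J_pos[OF k_pos]]
    by (simp add: backward_mean_def cond_dist_estimate_def)
qed (simp add: backward_mean_def cond_dist_estimate_def)

lemma default_mean_bounded: "\<bar>\<integral>y. y \<partial>Q\<bar> \<le> K"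
proof -
  interpret Q: prob_space Q by (rule Q)
  have "AE y in Q. y \<in> {-K..K}"
    using Q by (intro Q.AE_prob_1) simp
  then have bd: "AE y in Q. - K \<le> y" "AE y in Q. y \<le> K" by (eventually_elim, simp)+
  have [measurable]: "(\<lambda>y. y) \<in> borel_measurable Q"
    by (subst measurable_cong_sets[OF Q(2) refl]) simp
  have "AE y in Q. norm y \<le> K" using bd by eventually_elim auto
  then have int: "integrable Q (\<lambda>y. y)" by (rule Q.integrable_const_bound) simp
  show ?thesis
    using Q.integral_le_const[OF int bd(2)] Q.integral_ge_const[OF int bd(1)] by (simp add: abs_le_iff)
qed

lemma fits_iff:
  "x \<in> fits n \<longleftrightarrow> of_nat (l (k n)) + (\<Sum>j<J (k n). ennreal_of_enat
     (return_time (W (k n)) ((return_map (W (k n)) ^^ j) x))) \<le> of_nat n"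
proof -
  have "x \<in> fits n \<longleftrightarrow> ennreal_of_enat (sample_length (B (k n)) (l (k n)) (J (k n)) x) \<le> ennreal_of_enat (enat n)"
    by (simp only: ennreal_of_enat_le_iff mem_Collect_eq)
  then show ?thesis
    unfolding sample_length_def recurrence_time_eq_sum by (simp del: ennreal_of_enat_le_iff)
qed

lemma times_measurable:
  "(\<lambda>x. \<Sum>j<J (k n). ennreal_of_enat (return_time (W (k n)) ((return_map (W (k n)) ^^ j) x)))
     \<in> borel_measurable P"
proof -
  interpret w: bounded_labelled_paths P "W (k n)" "words (B (k n)) (l (k n))" K
    by (rule bounded_labelled_paths_word[OF k_pos])
  have [measurable]: "(\<lambda>x. ennreal_of_enat (return_time (W (k n)) x)) \<in> borel_measurable P"
    by measurable
  show ?thesis using w.return.funpow_measurable by measurable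
qed

lemma fits_measurable [measurable]: "fits n \<in> sets P"
proof -
  note times_measurable [measurable]
  have "{x \<in> space P. of_nat (l (k n)) + (\<Sum>j<J (k n). ennreal_of_enat
     (return_time (W (k n)) ((return_map (W (k n)) ^^ j) x))) \<le> of_nat n} \<in> sets P" by measurable
  moreover have "fits n = {x \<in> space P. of_nat (l (k n)) + (\<Sum>j<J (k n). ennreal_of_enat
     (return_time (W (k n)) ((return_map (W (k n)) ^^ j) x))) \<le> of_nat n}"
    using fits_iff[of _ n] unfolding set_eq_iff space_P by blast
  ultimately show ?thesis by simp
qed

lemma sample_measurable [measurable]: "sample_mean (W (k n)) (J (k n)) \<in> borel_measurable P"
proof -
  interpret w: bounded_labelled_paths P "W (k n)" "words (B (k n)) (l (k n))" K
    by (rule bounded_labelled_paths_word[OF k_pos])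
  show ?thesis by (rule w.sample_mean_measurable)
qed

lemma est_measurable [measurable]: "est n \<in> borel_measurable P"
proof -
  have "(\<lambda>x. if x \<in> fits n then sample_mean (W (k n)) (J (k n)) x else (\<integral>y. y \<partial>Q)) \<in> borel_measurable P"
    by (intro measurable_If_set) auto
  then show ?thesis by (simp only: est_eq[abs_def])
qed

lemma est_bounded: "AE x in P. \<bar>est n x\<bar> \<le> K"
proof -
  interpret w: bounded_labelled_paths P "W (k n)" "words (B (k n)) (l (k n))" K
    by (rule bounded_labelled_paths_word[OF k_pos])
  show ?thesis
    using w.sample_mean_bounded[of "J (k n)"]
    by eventually_elim (simp only: est_eq default_mean_bounded split: if_split, simp)
qed

text \<open>Markov's inequality: there are at most \<open>card (atoms (B (k n))) ^ l (k n)\<close> words, which bounds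
  the mean of each of the \<open>J (k n)\<close> return times; the growth condition leaves room
  for \<open>1 / \<epsilon>\<close> times the resulting bound on the mean of their sum.\<close>

lemma prob_not_fits:
  assumes g: "real n \<ge> real (l (k n)) + real (J (k n)) * real (card (atoms (B (k n)))) ^ l (k n) / \<epsilon> (k n)"
  shows "prob (- fits n) \<le> \<epsilon> (k n)"
proof -
  interpret w: bounded_labelled_paths P "W (k n)" "words (B (k n)) (l (k n))" K
    by (rule bounded_labelled_paths_word[OF k_pos])
  define u where "u x = (\<Sum>j<J (k n). ennreal_of_enat (return_time (W (k n)) ((return_map (W (k n)) ^^ j) x)))" for x
  define C where "C = card (words (B (k n)) (l (k n)))"
  have C: "C = card (atoms (B (k n))) ^ l (k n)"
    unfolding C_def by (subst card_PiE) auto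
  have "atoms (B (k n)) \<noteq> {}" using cell_in_atoms[OF field[OF k_pos] finite_field[OF k_pos]] by blast
  then have "C > 0"
    unfolding C using finite_atoms[OF finite_field[OF k_pos]] by (auto simp: card_gt_0_iff)
  then have Jc: "real (J (k n)) * real C > 0" using J_pos[OF k_pos, of n] by simp
  have eps: "\<epsilon> (k n) > 0" by (rule \<epsilon>_pos[OF k_pos])
  define c where "c = \<epsilon> (k n) / (real (J (k n)) * real C)"
  have c: "c > 0" using eps Jc by (simp add: c_def)
  have [measurable]: "u \<in> borel_measurable P" unfolding u_def by (rule times_measurable)
  have "- fits n \<subseteq> {x \<in> UNIV. 1 \<le> ennreal c * u x}"
  proof
    fix x assume "x \<in> - fits n"
    then have "\<not> of_nat (l (k n)) + u x \<le> of_nat n" using fits_iff[of x n] by (simp add: u_def)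
    then have less: "of_nat n < of_nat (l (k n)) + u x" by simp
    have "ennreal (1 / c) \<le> u x"
    proof (rule ccontr)
      assume "\<not> ennreal (1 / c) \<le> u x"
      then have "of_nat (l (k n)) + u x \<le> ennreal (real (l (k n))) + ennreal (1 / c)"
        by (intro add_mono) (auto simp: ennreal_of_nat_eq_real_of_nat)
      also have "\<dots> = ennreal (real (l (k n)) + 1 / c)" using c by (subst ennreal_plus) auto
      also have "\<dots> \<le> ennreal (real n)"
        using g by (intro ennreal_leI) (simp add: c_def C)
      finally show False using less by (simp add: ennreal_of_nat_eq_real_of_nat)
    qed
    then have "ennreal c * ennreal (1 / c) \<le> ennreal c * u x" by (intro mult_left_mono) auto
    then show "x \<in> {x \<in> UNIV. 1 \<le> ennreal c * u x}"
      using c by (simp add: ennreal_mult[symmetric])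
  qed
  then have "emeasure P (- fits n) \<le> emeasure P {x \<in> UNIV. 1 \<le> ennreal c * u x}"
  proof (rule emeasure_mono)
    have "{x \<in> space P. 1 \<le> ennreal c * u x} \<in> sets P" by measurable
    then show "{x \<in> UNIV. 1 \<le> ennreal c * u x} \<in> sets P" by simp
  qed
  also have "\<dots> \<le> ennreal c * (\<integral>\<^sup>+x. u x * indicator UNIV x \<partial>P)"
    using sets.top[of P] by (intro nn_integral_Markov_inequality) auto
  also have "\<dots> \<le> ennreal c * (of_nat (J (k n)) * of_nat C)"
    using w.expected_return_times[of "J (k n)"] unfolding u_def C_def
    by (intro mult_left_mono) simp_all
  also have "\<dots> = ennreal (c * (real (J (k n)) * real C))"
    using c by (simp add: ennreal_of_nat_eq_real_of_nat ennreal_mult)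
  also have "c * (real (J (k n)) * real C) = \<epsilon> (k n)"
    using Jc unfolding c_def by (metis less_numeral_extra(3) nonzero_eq_divide_eq)
  finally show ?thesis
    using eps by (simp add: emeasure_eq_measure)
qed

text \<open>Cylinders over members of some \<open>B j\<close> are decided by all sufficiently late words, and the
  \<open>B j\<close> generate the Borel sets.\<close>

lemma past_generated:
  "sets (past_of P) \<subseteq> sigma_sets UNIV
     {S \<in> sets P. \<exists>n. \<forall>x\<in>UNIV. \<forall>y\<in>UNIV. W (Suc n) x = W (Suc n) y \<longrightarrow> (x \<in> S \<longleftrightarrow> y \<in> S)}"
  (is "_ \<subseteq> sigma_sets UNIV ?G")
proof -
  have "(\<lambda>x. x) \<in> sigma UNIV ?G \<rightarrow>\<^sub>M past_of P"
  proof (rule measurable_pastI)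
    fix i :: int assume i: "i < 0"
    show "(\<lambda>x. x i) \<in> borel_measurable (sigma UNIV ?G)"
    proof (rule measurable_sigma_sets[OF field_gen[symmetric]])
      fix A assume "A \<in> (\<Union>j\<in>{1..}. B j)"
      then obtain j where j: "j \<ge> 1" "A \<in> B j" by auto
      obtain j' where j': "j' \<ge> 1" "nat (- i) \<le> l j'" using l_unbounded by blast
      obtain n where n: "Suc n = max j j'" using j(1) by (metis max.coboundedI1 Suc_le_D One_nat_def)
      have "A \<in> B (Suc n)" using field_mono[of j "Suc n"] j n by auto
      have "nat (- i) \<in> {1..l (Suc n)}" using l_mono[of j' "Suc n"] j' n i by auto
      have cylinder: "x i \<in> A \<longleftrightarrow> y i \<in> A" if eq: "W (Suc n) x = W (Suc n) y" for x y
      proof -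
        have "cell (B (Suc n)) (x (- int (nat (- i)))) = cell (B (Suc n)) (y (- int (nat (- i))))"
          using eq \<open>nat (- i) \<in> {1..l (Suc n)}\<close> unfolding word_eq_iff by blast
        then have "cell (B (Suc n)) (x i) = cell (B (Suc n)) (y i)" using i by simp
        moreover have "cell (B (Suc n)) (x i) = cell (B (Suc n)) (y i) \<longleftrightarrow> (\<forall>A\<in>B (Suc n). x i \<in> A \<longleftrightarrow> y i \<in> A)"
          by (rule cell_eq_iff[OF field finite_field]) simp_all
        ultimately show ?thesis using \<open>A \<in> B (Suc n)\<close> by blast
      qed
      have "(\<lambda>x. x i) -` A \<inter> space P \<in> sets P"
        using field_borel[OF j(1)] j(2) by (intro measurable_sets[OF coord_measurable]) auto
      then have "(\<lambda>x. x i) -` A \<in> sets P" by simp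
      moreover have "\<forall>x\<in>UNIV. \<forall>y\<in>UNIV. W (Suc n) x = W (Suc n) y \<longrightarrow>
          (x \<in> (\<lambda>x. x i) -` A \<longleftrightarrow> y \<in> (\<lambda>x. x i) -` A)"
        unfolding vimage_eq using cylinder by blast
      ultimately have "(\<lambda>x. x i) -` A \<in> ?G" by blast
      then show "(\<lambda>x. x i) -` A \<inter> space (sigma UNIV ?G) \<in> sets (sigma UNIV ?G)"
        by (simp add: sigma_sets.Basic)
    qed auto
  qed
  then show ?thesis
    using measurable_sets[of "\<lambda>x. x" "sigma UNIV ?G" "past_of P"] by auto
qed

lemma W_refine: "1 \<le> i \<Longrightarrow> i \<le> j \<Longrightarrow> W j x = W j y \<Longrightarrow> W i x = W i y"
  by (rule word_refine[OF field finite_field field finite_field field_mono l_mono]) auto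

lemma mean_approx:
  assumes "e > 0"
  obtains i h where "i \<ge> 1" "integrable P h" "\<forall>x y. W i x = W i y \<longrightarrow> h x = h y"
    "(\<integral>x. \<bar>m x - h x\<bar> \<partial>P) < e"
proof -
  have "\<exists>n h. integrable P h \<and> (\<forall>x\<in>space P. \<forall>y\<in>space P. W (Suc n) x = W (Suc n) y \<longrightarrow> h x = h y) \<and>
      (\<integral>x. \<bar>m x - h x\<bar> \<partial>P) < e"
  proof (rule approx_by_labels[where W = "\<lambda>n. W (Suc n)", OF _ subalgebra_past _ mean_past mean_integrable assms])
    show "W (Suc a) x = W (Suc a) y" if "a \<le> b" "W (Suc b) x = W (Suc b) y" for a b x y
      by (rule W_refine[OF _ _ that(2)]) (use that(1) in auto)
    show "sets (past_of P) \<subseteq> sigma_sets (space P) {S \<in> sets P. \<exists>n. \<forall>x\<in>space P. \<forall>y\<in>space P.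
        W (Suc n) x = W (Suc n) y \<longrightarrow> (x \<in> S \<longleftrightarrow> y \<in> S)}"
      unfolding space_P by (rule past_generated)
  qed
  then obtain n h where h: "integrable P h" "\<forall>x\<in>space P. \<forall>y\<in>space P. W (Suc n) x = W (Suc n) y \<longrightarrow> h x = h y"
    "(\<integral>x. \<bar>m x - h x\<bar> \<partial>P) < e" by (elim exE conjE)
  show thesis
  proof (rule that[OF _ h(1) _ h(3)])
    show "\<forall>x y. W (Suc n) x = W (Suc n) y \<longrightarrow> h x = h y"
      using h(2) unfolding space_P by blast
  qed simp
qed

lemma est_close:
  assumes g: "real n \<ge> real (l (k n)) + real (J (k n)) * real (card (atoms (B (k n)))) ^ l (k n) / \<epsilon> (k n)"
    and h: "integrable P h" "\<And>x y. W (k n) x = W (k n) y \<Longrightarrow> h x = h y"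
  shows "(\<integral>x. \<bar>est n x - m x\<bar> \<partial>P)
    \<le> 2 * K * \<epsilon> (k n) + 2 * K / sqrt (real (J (k n))) + 2 * (\<integral>x. \<bar>m x - h x\<bar> \<partial>P)"
proof -
  interpret w: bounded_labelled_paths P "W (k n)" "words (B (k n)) (l (k n))" K
    by (rule bounded_labelled_paths_word[OF k_pos])
  let ?s = "sample_mean (W (k n)) (J (k n))"
  have [measurable]: "- fits n \<in> sets P"
    using sets.compl_sets[OF fits_measurable[of n]] by (simp add: Compl_eq_Diff_UNIV)
  have int: "integrable P (\<lambda>x. \<bar>?s x - m x\<bar>)" "integrable P (\<lambda>x. 2 * K * indicator (- fits n) x)"
    using w.sample_mean_integrable mean_integrable by (auto simp: emeasure_eq_measure)
  have "(\<integral>x. \<bar>est n x - m x\<bar> \<partial>P) \<le> (\<integral>x. \<bar>?s x - m x\<bar> + 2 * K * indicator (- fits n) x \<partial>P)"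
  proof (rule integral_mono_AE)
    show "integrable P (\<lambda>x. \<bar>est n x - m x\<bar>)"
      using est_bounded[of n] mean_integrable
      by (intro integrable_abs Bochner_Integration.integrable_diff) (auto intro!: integrable_const_bound[of _ K])
    show "AE x in P. \<bar>est n x - m x\<bar> \<le> \<bar>?s x - m x\<bar> + 2 * K * indicator (- fits n) x"
      using mean_bounded est_bounded[of n]
    proof eventually_elim
      case (elim x)
      show ?case
      proof (cases "x \<in> fits n")
        case True
        then show ?thesis by (simp add: est_eq)
      next
        case False
        then have "indicator (- fits n) x = (1::real)" by simp
        then show ?thesis using elim by (simp only: mult_1_right)
      qed
    qed
  qed (use int in auto)
  also have "\<dots> = (\<integral>x. \<bar>?s x - m x\<bar> \<partial>P) + 2 * K * prob (- fits n)"
    using int by (simp add: Int_absorb2)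
  also have "\<dots> \<le> (2 * K / sqrt (real (J (k n))) + 2 * (\<integral>x. \<bar>m x - h x\<bar> \<partial>P)) + 2 * K * \<epsilon> (k n)"
    using w.sample_mean_close[OF J_pos[OF k_pos] h] prob_not_fits[OF g] K_pos
    by (intro add_mono mult_left_mono) auto
  finally show ?thesis by simp
qed

text \<open>The approximant \<open>h\<close> is chosen first. It is a function of one fixed word, hence of all later
  words, so the bound of \<open>est_close\<close> applies to it for all large \<open>n\<close>.\<close>

theorem est_consistent: "(\<lambda>n. \<integral>x. \<bar>est n x - m x\<bar> \<partial>P) \<longlonglongrightarrow> 0"
proof (rule LIMSEQ_I)
  fix e :: real assume "e > 0"
  then have "e / 8 > 0" by simp
  then obtain i h where ih: "i \<ge> 1" "integrable P h" "\<forall>x y. W i x = W i y \<longrightarrow> h x = h y"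
    "(\<integral>x. \<bar>m x - h x\<bar> \<partial>P) < e / 8"
    by (rule mean_approx)
  have "(\<lambda>n. \<epsilon> (k n)) \<longlonglongrightarrow> 0" by (rule filterlim_compose[OF \<epsilon>_lim k_lim])
  then have "(\<lambda>n. 2 * K * \<epsilon> (k n)) \<longlonglongrightarrow> 2 * K * 0" by (intro tendsto_intros)
  then have 1: "\<forall>\<^sub>F n in sequentially. 2 * K * \<epsilon> (k n) < e / 4"
    using \<open>e > 0\<close> by (intro order_tendstoD(2)) auto
  have "((\<lambda>j::nat. 2 * K / sqrt (real j)) \<longlongrightarrow> 0) at_top" by real_asymp
  then have "(\<lambda>n. 2 * K / sqrt (real (J (k n)))) \<longlonglongrightarrow> 0" by (rule filterlim_compose[OF _ J_lim])
  then have 2: "\<forall>\<^sub>F n in sequentially. 2 * K / sqrt (real (J (k n))) < e / 4"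
    using \<open>e > 0\<close> by (intro order_tendstoD(2)) auto
  have 3: "\<forall>\<^sub>F n in sequentially. i \<le> k n"
    using k_lim unfolding filterlim_at_top by blast
  have "\<forall>\<^sub>F n in sequentially. norm ((\<integral>x. \<bar>est n x - m x\<bar> \<partial>P) - 0) < e"
    using growth 1 2 3
  proof eventually_elim
    case (elim n)
    have "h x = h y" if "W (k n) x = W (k n) y" for x y
      using ih(3) W_refine[OF ih(1) elim(4) that] by blast
    note est_close[OF elim(1) ih(2) this]
    then show ?case using elim(2,3) ih(4) \<open>e > 0\<close> by simp
  qed
  then show "\<exists>n0. \<forall>n\<ge>n0. norm ((\<integral>x. \<bar>est n x - m x\<bar> \<partial>P) - 0) < e"
    unfolding eventually_sequentially .
qed

section \<open>Squared errors\<close>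

definition est_error :: "nat \<Rightarrow> (int \<Rightarrow> real) \<Rightarrow> real" where
  "est_error n x = \<bar>x 0 - est n x\<bar>\<^sup>2"

definition mean_error :: "(int \<Rightarrow> real) \<Rightarrow> real" where
  "mean_error x = \<bar>x 0 - m x\<bar>\<^sup>2"

lemma error_measurable [measurable]:
  "est_error n \<in> borel_measurable P" "mean_error \<in> borel_measurable P"
  unfolding est_error_def mean_error_def by measurable

lemma square_le: "\<bar>a - b\<bar>\<^sup>2 \<le> (2 * K)\<^sup>2" if "\<bar>a\<bar> \<le> K" "\<bar>b\<bar> \<le> K" for a b :: real
  using that by (intro power_mono) auto

lemma error_bounded:
  "AE x in P. \<bar>est_error n x\<bar> \<le> (2 * K)\<^sup>2" "AE x in P. \<bar>mean_error x\<bar> \<le> (2 * K)\<^sup>2"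
proof -
  show "AE x in P. \<bar>est_error n x\<bar> \<le> (2 * K)\<^sup>2"
    using coord_bounded[of 0] est_bounded[of n]
  proof eventually_elim
    case (elim x)
    then show ?case unfolding est_error_def abs_of_nonneg[OF zero_le_power2] by (rule square_le)
  qed
  show "AE x in P. \<bar>mean_error x\<bar> \<le> (2 * K)\<^sup>2"
    using coord_bounded[of 0] mean_bounded
  proof eventually_elim
    case (elim x)
    then show ?case unfolding mean_error_def abs_of_nonneg[OF zero_le_power2] by (rule square_le)
  qed
qed

lemma error_integrable: "integrable P (est_error n)" "integrable P mean_error"
proof -
  have "AE x in P. norm (est_error n x) \<le> (2 * K)\<^sup>2" "AE x in P. norm (mean_error x) \<le> (2 * K)\<^sup>2"
    unfolding real_norm_def by (rule error_bounded)+
  then show "integrable P (est_error n)" "integrable P mean_error"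
    by (intro integrable_const_bound; simp)+
qed

theorem est_error_L1: "(\<lambda>n. \<integral>x. \<bar>est_error n x - mean_error x\<bar> \<partial>P) \<longlonglongrightarrow> 0"
proof (rule tendsto_sandwich[OF _ _ tendsto_const])
  show "\<forall>\<^sub>F n in sequentially. (\<integral>x. \<bar>est_error n x - mean_error x\<bar> \<partial>P) \<le> 4 * K * (\<integral>x. \<bar>est n x - m x\<bar> \<partial>P)"
  proof (rule always_eventually, rule allI)
    fix n
    have int: "integrable P (est n)"
      using est_bounded[of n] by (intro integrable_const_bound[of _ K]) auto
    have "(\<integral>x. \<bar>est_error n x - mean_error x\<bar> \<partial>P) \<le> (\<integral>x. 4 * K * \<bar>est n x - m x\<bar> \<partial>P)"
    proof (rule integral_mono_AE)
      show "AE x in P. \<bar>est_error n x - mean_error x\<bar> \<le> 4 * K * \<bar>est n x - m x\<bar>"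
        using coord_bounded[of 0] est_bounded[of n] mean_bounded
      proof eventually_elim
        case (elim x)
        have "est_error n x - mean_error x = (2 * x 0 - est n x - m x) * (m x - est n x)"
          unfolding est_error_def mean_error_def power2_abs by (simp add: power2_eq_square algebra_simps)
        then have "\<bar>est_error n x - mean_error x\<bar> = \<bar>2 * x 0 - est n x - m x\<bar> * \<bar>est n x - m x\<bar>"
          by (simp add: abs_mult abs_minus_commute)
        also have "\<dots> \<le> 4 * K * \<bar>est n x - m x\<bar>"
          using elim by (intro mult_right_mono) auto
        finally show ?case .
      qed
    qed (use int mean_integrable error_integrable in auto)
    then show "(\<integral>x. \<bar>est_error n x - mean_error x\<bar> \<partial>P) \<le> 4 * K * (\<integral>x. \<bar>est n x - m x\<bar> \<partial>P)" by simp
  qed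
  show "(\<lambda>n. 4 * K * (\<integral>x. \<bar>est n x - m x\<bar> \<partial>P)) \<longlonglongrightarrow> 0"
    using tendsto_mult_right_zero[OF est_consistent] by simp
qed simp

text \<open>By stationarity, replacing \<open>est_error t\<close> by \<open>mean_error\<close> at time \<open>t\<close> costs as much as at
  time \<open>0\<close>; these costs tend to \<open>0\<close>, hence so do their averages. The ergodic theorem applies to
  what is left.\<close>

theorem average_error_L1:
  assumes erg: "\<And>A. A \<in> sets P \<Longrightarrow> shift -` A = A \<Longrightarrow> prob A \<in> {0, 1}"
  shows "(\<lambda>n. \<integral>x. \<bar>(\<Sum>t<n. est_error t ((shift ^^ t) x)) / real n - (\<integral>x. mean_error x \<partial>P)\<bar> \<partial>P) \<longlonglongrightarrow> 0"
proof (rule tendsto_sandwich[OF _ _ tendsto_const])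
  let ?I = "\<integral>x. mean_error x \<partial>P"
  let ?a = "\<lambda>t. \<integral>x. \<bar>est_error t x - mean_error x\<bar> \<partial>P"
  let ?b = "\<lambda>n. \<integral>x. \<bar>(\<Sum>t<n. mean_error ((shift ^^ t) x)) / real n - ?I\<bar> \<partial>P"
  show "\<forall>\<^sub>F n in sequentially. (\<integral>x. \<bar>(\<Sum>t<n. est_error t ((shift ^^ t) x)) / real n - ?I\<bar> \<partial>P)
      \<le> (\<Sum>t<n. ?a t) / real n + ?b n"
  proof (rule always_eventually, rule allI)
    fix n
    have d: "integrable P (\<lambda>x. \<bar>est_error t x - mean_error x\<bar>)" for t
      using error_integrable by auto
    note i = integrable_funpow[OF error_integrable(1)] integrable_funpow[OF error_integrable(2)]
      integrable_funpow[OF d]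
    have "(\<integral>x. \<bar>(\<Sum>t<n. est_error t ((shift ^^ t) x)) / real n - ?I\<bar> \<partial>P)
      \<le> (\<integral>x. (\<Sum>t<n. \<bar>est_error t ((shift ^^ t) x) - mean_error ((shift ^^ t) x)\<bar>) / real n
          + \<bar>(\<Sum>t<n. mean_error ((shift ^^ t) x)) / real n - ?I\<bar> \<partial>P)"
    proof (rule integral_mono)
      fix x
      have "(\<Sum>t<n. est_error t ((shift ^^ t) x)) / real n - ?I
          = (\<Sum>t<n. est_error t ((shift ^^ t) x) - mean_error ((shift ^^ t) x)) / real n
          + ((\<Sum>t<n. mean_error ((shift ^^ t) x)) / real n - ?I)"
        by (simp add: sum_subtractf diff_divide_distrib)
      moreover have "\<bar>(\<Sum>t<n. est_error t ((shift ^^ t) x) - mean_error ((shift ^^ t) x)) / real n\<bar>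
          \<le> (\<Sum>t<n. \<bar>est_error t ((shift ^^ t) x) - mean_error ((shift ^^ t) x)\<bar>) / real n"
        unfolding abs_divide by (auto intro!: divide_right_mono sum_abs)
      ultimately show "\<bar>(\<Sum>t<n. est_error t ((shift ^^ t) x)) / real n - ?I\<bar>
          \<le> (\<Sum>t<n. \<bar>est_error t ((shift ^^ t) x) - mean_error ((shift ^^ t) x)\<bar>) / real n
          + \<bar>(\<Sum>t<n. mean_error ((shift ^^ t) x)) / real n - ?I\<bar>" by linarith
    qed (use i in auto)
    also have "\<dots> = (\<Sum>t<n. \<integral>x. \<bar>est_error t ((shift ^^ t) x) - mean_error ((shift ^^ t) x)\<bar> \<partial>P) / real n + ?b n"
      using i by simp
    also have "(\<Sum>t<n. \<integral>x. \<bar>est_error t ((shift ^^ t) x) - mean_error ((shift ^^ t) x)\<bar> \<partial>P) = (\<Sum>t<n. ?a t)"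
      using integral_funpow[of "\<lambda>x. \<bar>est_error _ x - mean_error x\<bar>"] by (intro sum.cong refl) simp
    finally show "(\<integral>x. \<bar>(\<Sum>t<n. est_error t ((shift ^^ t) x)) / real n - ?I\<bar> \<partial>P) \<le> (\<Sum>t<n. ?a t) / real n + ?b n" .
  qed
  have "?b \<longlonglongrightarrow> 0"
    using erg by (intro ergodic_theorem_L1[where f = mean_error, OF _ _ error_bounded(2)]) simp_all
  then show "(\<lambda>n. (\<Sum>t<n. ?a t) / real n + ?b n) \<longlonglongrightarrow> 0"
    using tendsto_add[OF cesaro_zero[OF est_error_L1]] by simp
qed simp

end

section \<open>From the path space to the process\<close>

text \<open>The shift acts on paths and not on the probability space of the process. The conditional mean
  can be computed on path space, because events of the past of the process are preimages of
  events of the past of the path.\<close>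

lemma past_mean_path:
  fixes X :: "int \<Rightarrow> 'a \<Rightarrow> real"
  assumes M: "prob_space M" and X [measurable]: "\<And>t. X t \<in> borel_measurable M"
    and P: "bounded_paths (path_law M X) K"
  shows "AE \<omega> in M. past_mean M X \<omega> = past_mean (path_law M X) (\<lambda>t x. x t) (\<lambda>t. X t \<omega>)"
proof -
  interpret M: prob_space M by fact
  interpret bounded_paths "path_law M X" K by fact
  let ?path = "\<lambda>\<omega> t. X t \<omega>"
  let ?F = "past_algebra M X"
  have path: "?path \<in> M \<rightarrow>\<^sub>M Pi\<^sub>M UNIV (\<lambda>_. borel)"
    by (rule measurable_PiM_single') auto
  interpret F: sigma_finite_subalgebra M ?F
    by (rule finite_measure_subalgebra_is_sigma_finite) (unfold_locales, rule subalgebra_past_algebra[OF X])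
  have past_path: "?path \<in> ?F \<rightarrow>\<^sub>M past_of (path_law M X)"
    by (intro measurable_pastI coord_past_algebra)
  have distr: "(\<integral>\<omega>. f (?path \<omega>) \<partial>M) = (\<integral>x. f x \<partial>path_law M X)"
    if "f \<in> borel_measurable (path_law M X)" for f :: "(int \<Rightarrow> real) \<Rightarrow> real"
    using that unfolding path_law_def by (intro integral_distr[symmetric] path) simp
  have int_distr: "integrable M (\<lambda>\<omega>. f (?path \<omega>))" if "integrable (path_law M X) f" for f :: "(int \<Rightarrow> real) \<Rightarrow> real"
    using that unfolding path_law_def by (rule integrable_distr[OF path])
  show ?thesis
    unfolding past_mean_def[of M]
  proof (rule F.real_cond_exp_charact)
    fix A assume "A \<in> sets ?F"
    then obtain C where C: "C \<in> sets (Pi\<^sub>M {..<0} (\<lambda>_. borel))"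
      "A = (\<lambda>\<omega>. \<lambda>t\<in>{..<0}. X t \<omega>) -` C \<inter> space M"
      unfolding past_algebra_def
      by (subst (asm) sets_vimage_algebra2) (auto simp: space_PiM)
    define S where "S = (\<lambda>x. \<lambda>t\<in>{..<0}. x t) -` C \<inter> space (path_law M X)"
    have S: "S \<in> sets (past_of (path_law M X))"
      unfolding S_def past_algebra_def by (rule in_vimage_algebra[OF C(1)])
    then have S' [measurable]: "S \<in> sets (path_law M X)"
      using subalgebra_past unfolding subalgebra_def by blast
    have A: "indicator A \<omega> = (indicator S (?path \<omega>) :: real)" if "\<omega> \<in> space M" for \<omega>
      using that by (auto simp: indicator_def S_def C(2))
    have eq: "(\<integral>\<omega>\<in>A. f (?path \<omega>) \<partial>M) = (\<integral>x\<in>S. f x \<partial>path_law M X)"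
      if [measurable]: "f \<in> borel_measurable (path_law M X)" for f :: "(int \<Rightarrow> real) \<Rightarrow> real"
    proof -
      have "(\<integral>\<omega>\<in>A. f (?path \<omega>) \<partial>M) = (\<integral>\<omega>. indicator S (?path \<omega>) *\<^sub>R f (?path \<omega>) \<partial>M)"
        unfolding set_lebesgue_integral_def by (intro Bochner_Integration.integral_cong) (auto simp: A)
      also have "\<dots> = (\<integral>x\<in>S. f x \<partial>path_law M X)"
        unfolding set_lebesgue_integral_def by (rule distr) measurable
      finally show ?thesis .
    qed
    have "(\<integral>\<omega>\<in>A. X 0 \<omega> \<partial>M) = (\<integral>x\<in>S. x 0 \<partial>path_law M X)"
      using eq[OF coord_measurable] .
    also have "\<dots> = (\<integral>x\<in>S. m x \<partial>path_law M X)"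
      unfolding past_mean_def by (rule past.real_cond_exp_intA[OF coord_integrable S])
    also have "\<dots> = (\<integral>\<omega>\<in>A. m (?path \<omega>) \<partial>M)"
      using eq[OF mean_measurable] ..
    finally show "(\<integral>\<omega>\<in>A. X 0 \<omega> \<partial>M) = (\<integral>\<omega>\<in>A. m (?path \<omega>) \<partial>M)" .
  next
    show "integrable M (X 0)" using int_distr[OF coord_integrable[of 0]] by simp
    show "integrable M (\<lambda>\<omega>. m (?path \<omega>))" by (rule int_distr[OF mean_integrable])
    show "(\<lambda>\<omega>. m (?path \<omega>)) \<in> borel_measurable ?F"
      by (rule measurable_compose[OF past_path mean_past])
  qed
qed

theorem mainTheorem9:
  fixes M :: "'a measure" and X :: "int \<Rightarrow> 'a \<Rightarrow> real" and K :: real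
    and B :: "nat \<Rightarrow> real set set" and l J k :: "nat \<Rightarrow> nat"
    and \<epsilon> :: "nat \<Rightarrow> real" and Q :: "real measure"
  assumes "K > 0"
    and "prob_space M"
    and "\<And>t. X t \<in> borel_measurable M"
    and "\<And>t \<omega>. \<omega> \<in> space M \<Longrightarrow> X t \<omega> \<in> {-K..K}"
    and "stationary M X"
    and "ergodic M X"
    and "\<And>i. i \<ge> 1 \<Longrightarrow> finite (B i)"
    and "\<And>i. i \<ge> 1 \<Longrightarrow> generated_by_intervals (B i)"
    and "mono_on {1..} B"
    and "sigma_sets UNIV (\<Union>i\<in>{1..}. B i) = sets borel"
    and "\<And>i. i \<ge> 1 \<Longrightarrow> l i > 0" and "mono_on {1..} l" and "\<not> bdd_above (l ` {1..})"
    and "\<And>i. i \<ge> 1 \<Longrightarrow> J i > 0" and "mono_on {1..} J" and "\<not> bdd_above (J ` {1..})"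
    and "\<And>n. k n > 0" and "mono k" and "\<not> bdd_above (range k)"
    and "\<And>i. i \<ge> 1 \<Longrightarrow> \<epsilon> i > 0" and "\<epsilon> \<longlonglongrightarrow> 0"
    and "\<forall>\<^sub>F n in sequentially.
           real n \<ge> real (l (k n)) + real (J (k n)) * real (card (atoms (B (k n)))) ^ l (k n) / \<epsilon> (k n)"
    and "prob_space Q" and "sets Q = sets borel" and "measure Q {-K..K} = 1"
  shows "L1_tendsto M (\<lambda>t \<omega>. \<bar>X 0 \<omega> - backward_mean B l J k Q X t \<omega>\<bar>\<^sup>2)
           (\<lambda>\<omega>. \<bar>X 0 \<omega> - past_mean M X \<omega>\<bar>\<^sup>2)
       \<and> L1_tendsto M (\<lambda>n \<omega>. (\<Sum>t<n. \<bar>X (int t) \<omega> - forward_mean B l J k Q X t \<omega>\<bar>\<^sup>2) / real n)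
           (\<lambda>_. \<integral>\<omega>. \<bar>X 0 \<omega> - past_mean M X \<omega>\<bar>\<^sup>2 \<partial>M)"
proof -
  interpret M: prob_space M by fact
  note X [measurable] = assms(3)
  define P where "P = path_law M X"
  let ?path = "\<lambda>\<omega> t. X t \<omega>"
  have path: "?path \<in> M \<rightarrow>\<^sub>M Pi\<^sub>M UNIV (\<lambda>_. borel)"
    by (rule measurable_PiM_single') auto
  have sets_P: "sets P = sets (Pi\<^sub>M UNIV (\<lambda>_. borel))" by (simp add: P_def path_law_def)
  have B_mono: "B i \<subseteq> B j" if "1 \<le> i" "i \<le> j" for i j
    using that by (intro mono_onD[OF assms(9)]) auto
  have l_mono: "l i \<le> l j" if "1 \<le> i" "i \<le> j" for i j
    using that by (intro mono_onD[OF assms(12)]) auto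
  have J_mono: "J i \<le> J j" if "1 \<le> i" "i \<le> j" for i j
    using that by (intro mono_onD[OF assms(15)]) auto
  have unbounded: "\<exists>i\<in>A. N \<le> f i" if "\<not> bdd_above (f ` A)" for f :: "nat \<Rightarrow> nat" and A N
    using that unfolding bdd_above_def by (metis imageE nat_le_linear)
  have k_lim: "filterlim k at_top sequentially"
    unfolding filterlim_at_top eventually_sequentially
  proof
    fix N
    obtain n where "N \<le> k n" using unbounded[OF assms(19)] by blast
    then show "\<exists>n. \<forall>n'\<ge>n. N \<le> k n'" using monoD[OF assms(18)] order_trans by blast
  qed
  have J_lim: "filterlim (\<lambda>n. J (k n)) at_top sequentially"
    unfolding filterlim_at_top
  proof
    fix N
    obtain i where i: "i \<ge> 1" "N \<le> J i" using unbounded[OF assms(16)] by auto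
    have "\<forall>\<^sub>F n in sequentially. i \<le> k n" using k_lim unfolding filterlim_at_top by blast
    then show "\<forall>\<^sub>F n in sequentially. N \<le> J (k n)"
      by eventually_elim (use i J_mono order_trans in blast)
  qed
  have l_unbounded: "\<exists>i\<ge>1. N \<le> l i" for N
    using unbounded[OF assms(13), of N] by auto
  have prob_P: "prob_space P"
    unfolding P_def path_law_def by (rule M.prob_space_distr[OF path])
  have "distr P P shift = distr P (Pi\<^sub>M UNIV (\<lambda>_. borel)) shift"
    by (rule distr_cong) (simp_all add: sets_P)
  then have shift_P: "distr P P shift = P" using assms(5) by (simp add: P_def stationary_def)
  interpret P: stationary_paths P
    by (intro stationary_paths.intro stationary_paths_axioms.intro prob_P sets_P shift_P)
  have AE_path: "AE x in P. R x" if "{x \<in> space P. R x} \<in> sets P" "\<And>\<omega>. \<omega> \<in> space M \<Longrightarrow> R (?path \<omega>)" for R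
  proof -
    have "{x \<in> space (Pi\<^sub>M UNIV (\<lambda>_. borel)). R x} \<in> sets (Pi\<^sub>M UNIV (\<lambda>_. borel))"
      using that(1) sets_eq_imp_space_eq[OF sets_P] by (simp add: sets_P)
    then show ?thesis
      unfolding P_def path_law_def using that(2) by (simp add: AE_distr_iff[OF path])
  qed
  have bounded: "AE x in P. \<forall>i. \<bar>x i\<bar> \<le> K"
  proof (rule AE_path)
    show "{x \<in> space P. \<forall>i. \<bar>x i\<bar> \<le> K} \<in> sets P" by measurable
    show "\<forall>i. \<bar>X i \<omega>\<bar> \<le> K" if "\<omega> \<in> space M" for \<omega>
      using assms(4)[OF that] by (simp add: abs_le_iff) (meson minus_le_iff)
  qed
  interpret P: forecast P K B l J k \<epsilon> Q
  proof (intro forecast.intro forecast_axioms.intro bounded_paths.intro bounded_paths_axioms.intro P.stationary_paths_axioms)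
    show "algebra UNIV (B i)" if "i \<ge> 1" for i
      by (rule algebra_generated_by_intervals[OF assms(8)[OF that]])
    show "1 \<le> J i" if "i \<ge> 1" for i using assms(14)[OF that] by simp
    show "1 \<le> k n" for n using assms(17)[of n] by simp
  qed (fact assms bounded B_mono l_mono l_unbounded k_lim J_lim)+
  have distr: "(\<integral>\<omega>. f (?path \<omega>) \<partial>M) = (\<integral>x. f x \<partial>P)" if "f \<in> borel_measurable P" for f :: "(int \<Rightarrow> real) \<Rightarrow> real"
    using that unfolding P_def path_law_def by (intro integral_distr[symmetric] path) simp
  have int_distr: "integrable M (\<lambda>\<omega>. f (?path \<omega>))" if "integrable P f" for f :: "(int \<Rightarrow> real) \<Rightarrow> real"
    using that unfolding P_def path_law_def by (rule integrable_distr[OF path])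
  have backward_eq: "\<bar>X 0 \<omega> - backward_mean B l J k Q X t \<omega>\<bar>\<^sup>2 = P.est_error t (?path \<omega>)" for t \<omega>
    by (simp add: P.est_error_def backward_mean_def)
  have forward_eq: "\<bar>X (int t) \<omega> - forward_mean B l J k Q X t \<omega>\<bar>\<^sup>2 = P.est_error t ((shift ^^ t) (?path \<omega>))" for t \<omega>
    by (simp add: P.est_error_def backward_mean_def forward_mean_def funpow_shift add.commute)
  have [measurable]: "past_mean M X \<in> borel_measurable M"
    unfolding past_mean_def by (rule borel_measurable_cond_exp2)
  have path_P [measurable]: "?path \<in> M \<rightarrow>\<^sub>M P" using path by (simp add: measurable_cong_sets[OF refl sets_P])
  have mean: "AE \<omega> in M. \<bar>X 0 \<omega> - past_mean M X \<omega>\<bar>\<^sup>2 = P.mean_error (?path \<omega>)"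
    using past_mean_path[OF assms(2,3) P.bounded_paths_axioms[unfolded P_def], folded P_def]
    by eventually_elim (simp add: P.mean_error_def)
  have mean_int: "integrable M (\<lambda>\<omega>. \<bar>X 0 \<omega> - past_mean M X \<omega>\<bar>\<^sup>2)"
    using int_distr[OF P.error_integrable(2)] mean
    by (subst integrable_cong_AE[where g = "\<lambda>\<omega>. P.mean_error (?path \<omega>)"]) auto
  have mean_val: "(\<integral>\<omega>. \<bar>X 0 \<omega> - past_mean M X \<omega>\<bar>\<^sup>2 \<partial>M) = (\<integral>x. P.mean_error x \<partial>P)"
    using mean by (subst distr[symmetric]) (auto intro!: integral_cong_AE)
  have "L1_tendsto M (\<lambda>t \<omega>. \<bar>X 0 \<omega> - backward_mean B l J k Q X t \<omega>\<bar>\<^sup>2)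
           (\<lambda>\<omega>. \<bar>X 0 \<omega> - past_mean M X \<omega>\<bar>\<^sup>2)"
    unfolding L1_tendsto_def
  proof (intro conjI allI)
    show "integrable M (\<lambda>\<omega>. \<bar>X 0 \<omega> - backward_mean B l J k Q X t \<omega>\<bar>\<^sup>2)" for t
      unfolding backward_eq by (rule int_distr[OF P.error_integrable(1)])
    have "(\<integral>\<omega>. \<bar>\<bar>X 0 \<omega> - backward_mean B l J k Q X t \<omega>\<bar>\<^sup>2 - \<bar>X 0 \<omega> - past_mean M X \<omega>\<bar>\<^sup>2\<bar> \<partial>M)
        = (\<integral>x. \<bar>P.est_error t x - P.mean_error x\<bar> \<partial>P)" for t
    proof -
      have "(\<integral>\<omega>. \<bar>\<bar>X 0 \<omega> - backward_mean B l J k Q X t \<omega>\<bar>\<^sup>2 - \<bar>X 0 \<omega> - past_mean M X \<omega>\<bar>\<^sup>2\<bar> \<partial>M)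
          = (\<integral>\<omega>. \<bar>P.est_error t (?path \<omega>) - P.mean_error (?path \<omega>)\<bar> \<partial>M)"
        unfolding backward_eq
      proof (rule integral_cong_AE)
        show "AE \<omega> in M. \<bar>P.est_error t (?path \<omega>) - \<bar>X 0 \<omega> - past_mean M X \<omega>\<bar>\<^sup>2\<bar>
            = \<bar>P.est_error t (?path \<omega>) - P.mean_error (?path \<omega>)\<bar>"
          using mean by eventually_elim (simp only:)
      qed measurable
      also have "\<dots> = (\<integral>x. \<bar>P.est_error t x - P.mean_error x\<bar> \<partial>P)" by (rule distr) measurable
      finally show ?thesis .
    qed
    then show "(\<lambda>t. \<integral>\<omega>. \<bar>\<bar>X 0 \<omega> - backward_mean B l J k Q X t \<omega>\<bar>\<^sup>2 - \<bar>X 0 \<omega> - past_mean M X \<omega>\<bar>\<^sup>2\<bar> \<partial>M) \<longlonglongrightarrow> 0"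
      using P.est_error_L1 by (simp only:)
  qed (rule mean_int)
  moreover have "L1_tendsto M (\<lambda>n \<omega>. (\<Sum>t<n. \<bar>X (int t) \<omega> - forward_mean B l J k Q X t \<omega>\<bar>\<^sup>2) / real n)
           (\<lambda>_. \<integral>\<omega>. \<bar>X 0 \<omega> - past_mean M X \<omega>\<bar>\<^sup>2 \<partial>M)"
    unfolding L1_tendsto_def forward_eq mean_val
  proof (intro conjI allI)
    show "integrable M (\<lambda>\<omega>. (\<Sum>t<n. P.est_error t ((shift ^^ t) (?path \<omega>))) / real n)" for n
      by (rule int_distr[of "\<lambda>x. (\<Sum>t<n. P.est_error t ((shift ^^ t) x)) / real n"])
         (intro integrable_divide Bochner_Integration.integrable_sum P.integrable_funpow P.error_integrable)
    have "P.prob A \<in> {0, 1}" if "A \<in> sets P" "shift -` A = A" for A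
      using assms(6) that unfolding ergodic_def P_def[symmetric] sets_P by blast
    then have "(\<lambda>n. \<integral>x. \<bar>(\<Sum>t<n. P.est_error t ((shift ^^ t) x)) / real n - (\<integral>x. P.mean_error x \<partial>P)\<bar> \<partial>P) \<longlonglongrightarrow> 0"
      by (rule P.average_error_L1)
    moreover have "(\<integral>\<omega>. \<bar>(\<Sum>t<n. P.est_error t ((shift ^^ t) (?path \<omega>))) / real n - (\<integral>x. P.mean_error x \<partial>P)\<bar> \<partial>M)
        = (\<integral>x. \<bar>(\<Sum>t<n. P.est_error t ((shift ^^ t) x)) / real n - (\<integral>x. P.mean_error x \<partial>P)\<bar> \<partial>P)" for n
      by (rule distr) measurable
    ultimately show "(\<lambda>n. \<integral>\<omega>. \<bar>(\<Sum>t<n. P.est_error t ((shift ^^ t) (?path \<omega>))) / real n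
        - (\<integral>x. P.mean_error x \<partial>P)\<bar> \<partial>M) \<longlonglongrightarrow> 0" by (simp only:)
  qed simp
  ultimately show ?thesis ..
qed

end
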